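(* Let $\mathcal M$ be an $A^*$-algebra (a $C^*$-algebra or a $W^*$-algebra) and let $X=(X(n))_{n\in\mathbb Z_+}$ be a standard subproduct system over $\mathcal M$. Let $\pi:\mathcal M\to B(\mathcal E)$ be a representation on a Hilbert space $\mathcal E$, and let $T=(T_n)_{n\in\mathbb Z_+}$ be a covariant representation of $X$ on a Hilbert space $\mathcal H$. Let $\Pi:\mathcal F_X\bigotimes_\pi\mathcal E\to\mathcal H$ be a partial isometry such that $\Pi(S_n(\zeta)\otimes I_{\mathcal E})=T_n(\zeta)\Pi$ for every $\zeta\in X(n)$, $n\in\mathbb Z_+$. Then $\mathcal S:=\Pi(\mathcal F_X\bigotimes_\pi\mathcal E)$ is a closed $T$-invariant subspace, $\mathcal W:=\mathcal S\ominus\mathfrak L(\mathcal S)$ is a wandering subspace for $T|_{\mathcal S}:=(T_n|_{\mathcal S})_{n\in\mathbb Z_+}$, and $$\mathcal W=\Pi\Big((\ker\Pi)^\perp\cap\big(\mathcal M\textstyle\bigotimes_\pi\mathcal E\big)\Big).$$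
   Context: Conventions. ``$A^*$'' means either $C^*$ or $W^*$, fixed throughout the statement. A $C^*$-correspondence over a $C^*$-algebra $\mathcal M$ is a Hilbert $\mathcal M$-module $E$ with a left action given by a non-degenerate (non-zero) $*$-homomorphism $\phi:\mathcal M\to\mathcal L(E)$ into the adjointable operators, $a\xi:=\phi(a)\xi$. A $W^*$-correspondence over a $W^*$-algebra is a $C^*$-correspondence that is self-dual with $\phi$ normal. Tensor products $F\otimes E$ of correspondences are the interior ones (in the $W^*$-case, their self-dual extensions; infinite direct sums are likewise self-dual). For a representation $\pi$ of $\mathcal M$ on a Hilbert space $\mathcal E$, $E\bigotimes_\pi\mathcal E$ is the Hilbert space with $\langle\xi_1\otimes h_1,\xi_2\otimes h_2\rangle=\langle h_1,\pi(\langle\xi_1,\xi_2\rangle)h_2\rangle$. Representations of $\mathcal M$ on Hilbert spaces are non-degenerate $*$-representations, normal in the $W^*$-case. Standard subproduct system over $\mathcal M$: a sequence $X=(X(n))_{n\in\mathbb Z_+}$ of $A^*$-correspondences over $\mathcal M$ with $X(0)=\mathcal M$ and $X(n+m)$ an orthogonally complementable sub-bimodule of $X(n)\otimes X(m)$ for all $n,m$. Put $E:=X(1)$; then $X(n)\subseteq E^{\otimes n}$ ($E^{\otimes0}=\mathcal M$) is complemented, with orthogonal projection $p_n\in\mathcal L(E^{\otimes n})$ onto $X(n)$; the $p_n$ are bimodule maps and $p_{n+m}=p_{n+m}(I_{E^{\otimes n}}\otimes p_m)=p_{n+m}(p_n\otimes I_{E^{\otimes m}})$. (For $n=0$ or $m=0$,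 $\mathcal M\otimes X(m)$ and $X(n)\otimes\mathcal M$ are identified with $X(m)$, $X(n)$ via the module actions.) Covariant representation of $X$ on $\mathcal H$: a family $T=(T_n)_{n\in\mathbb Z_+}$ of bounded linear maps $T_n:X(n)\to B(\mathcal H)$ such that $\sigma:=T_0$ is a representation of $\mathcal M$, $T_n(a\zeta a')=\sigma(a)T_n(\zeta)\sigma(a')$ for $a,a'\in\mathcal M$, $\zeta\in X(n)$, and $T_{n+m}(p_{n+m}(\zeta\otimes\eta))=T_n(\zeta)T_m(\eta)$ for $\zeta\in X(n)$, $\eta\in X(m)$; in the $W^*$-case each $T_n$ is also continuous from the $\sigma$-topology of $X(n)$ (generated by the functionals $\sum_i\omega_i(\langle\eta_i,\cdot\rangle)$, $\eta_i\in X(n)$, $\omega_i\in\mathcal M_*$, $\sum\|\omega_i\|\|\eta_i\|<\infty$) to the ultraweak topology of $B(\mathcal H)$. Fock space and shift: $\mathcal F_X:=\bigoplus_{n\in\mathbb Z_+}X(n)$, $S_n:X(n)\to\mathcal L(\mathcal F_X)$, $S_n(\zeta)\eta:=p_{n+m}(\zeta\otimes\eta)$ for $\eta\in X(m)$. $\mathcal M\bigotimes_\pi\mathcal E=X(0)\bigotimes_\pi\mathcal E$ is regarded as the $n=0$ summand of $\mathcal F_X\bigotimes_\pi\mathcal E$. A closed subspace $\mathcal S\subseteq\mathcal H$ is $T$-invariant if it is invariant under $\sigma(\mathcal M)$ and under every $T_n(\zeta)$, $\zeta\in X(n)$, $n\in\mathbb N$. For a closed subspace $\mathcal S\subseteq\mathcal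 H$ put $\mathfrak L_n(\mathcal S)=\mathfrak L_n(\mathcal S,T):=\bigvee\{T_n(p_n(\zeta))s:\zeta\in E^{\otimes n},\ s\in\mathcal S\}$ ($\bigvee$ = closed linear span) and $\mathfrak L(\mathcal S):=\mathfrak L_1(\mathcal S)$. A closed subspace $\mathcal W$ is wandering for $T$ if it is $\sigma(\mathcal M)$-invariant and $\mathcal W\perp\mathfrak L_n(\mathcal W,T)$ for every $n\in\mathbb N=\{1,2,\dots\}$. $\mathcal S\ominus\mathfrak L(\mathcal S)$ is the orthogonal complement of $\mathfrak L(\mathcal S)$ in $\mathcal S$. *)

theory Defs
  imports "HOL-Analysis.Analysis"
begin

section \<open>Complex Banach spaces, Hilbert spaces and C*-algebras\<close>

class complex_normed_vector = real_normed_vector +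
  fixes scaleC :: "complex \<Rightarrow> 'a \<Rightarrow> 'a"  (infixr \<open>*\<^sub>C\<close> 75)
  assumes scaleC_add_right: "c *\<^sub>C (x + y) = c *\<^sub>C x + c *\<^sub>C y"
    and scaleC_add_left: "(c + d) *\<^sub>C x = c *\<^sub>C x + d *\<^sub>C x"
    and scaleC_scaleC: "c *\<^sub>C (d *\<^sub>C x) = (c * d) *\<^sub>C x"
    and scaleR_scaleC: "r *\<^sub>R x = complex_of_real r *\<^sub>C x"
    and norm_scaleC: "norm (c *\<^sub>C x) = cmod c * norm x"

class cbanach = complex_normed_vector + banach

instantiation complex :: cbanach
begin
definition scaleC_complex :: "complex \<Rightarrow> complex \<Rightarrow> complex"
  where "scaleC_complex = (*)"
instance
  by standard (simp_all add: scaleC_complex_def algebra_simps norm_mult scaleR_conv_of_real)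
end

text \<open>The inner product is conjugate linear in the first variable.  The last axiom contains both
  positive definiteness and the fact that the norm is the one given by the inner product.\<close>

class chilbert_space = cbanach +
  fixes cinner :: "'a \<Rightarrow> 'a \<Rightarrow> complex"
  assumes cinner_commute: "cinner x y = cnj (cinner y x)"
    and cinner_add_right: "cinner x (y + z) = cinner x y + cinner x z"
    and cinner_scaleC_right: "cinner x (c *\<^sub>C y) = c * cinner x y"
    and cinner_self: "cinner x x = complex_of_real ((norm x)\<^sup>2)"

text \<open>C*-algebras are not assumed to be unital.\<close>

class cstar_algebra = cbanach + real_normed_algebra +
  fixes star :: "'a \<Rightarrow> 'a"
  assumes mult_scaleC_left: "(c *\<^sub>C a) * b = c *\<^sub>C (a * b)"
    and mult_scaleC_right: "a * (c *\<^sub>C b) = c *\<^sub>C (a * b)"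
    and star_star: "star (star a) = a"
    and star_add: "star (a + b) = star a + star b"
    and star_scaleC: "star (c *\<^sub>C a) = cnj c *\<^sub>C star a"
    and star_mult: "star (a * b) = star b * star a"
    and cstar_identity: "norm (star a * a) = (norm a)\<^sup>2"

definition positive_element :: "'m::cstar_algebra \<Rightarrow> bool"
  where "positive_element a \<longleftrightarrow> (\<exists>b. a = star b * b)"

definition csubspace :: "'a::complex_normed_vector set \<Rightarrow> bool"
  where "csubspace V \<longleftrightarrow>
    0 \<in> V \<and> (\<forall>x\<in>V. \<forall>y\<in>V. x + y \<in> V) \<and> (\<forall>c. \<forall>x\<in>V. c *\<^sub>C x \<in> V)"

definition cspan :: "'a::complex_normed_vector set \<Rightarrow> 'a set"
  where "cspan B = csubspace hull B"

definition clinear_on ::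
    "'a::complex_normed_vector set \<Rightarrow> ('a \<Rightarrow> 'b::complex_normed_vector) \<Rightarrow> bool"
  where "clinear_on V f \<longleftrightarrow>
    (\<forall>x\<in>V. \<forall>y\<in>V. f (x + y) = f x + f y) \<and> (\<forall>c. \<forall>x\<in>V. f (c *\<^sub>C x) = c *\<^sub>C f x)"

definition bounded_clinear ::
    "('a::complex_normed_vector \<Rightarrow> 'b::complex_normed_vector) \<Rightarrow> bool"
  where "bounded_clinear f \<longleftrightarrow> clinear_on UNIV f \<and> (\<exists>C. \<forall>x. norm (f x) \<le> C * norm x)"

definition orth :: "'h::chilbert_space set \<Rightarrow> 'h set"
  where "orth V = {x. \<forall>y\<in>V. cinner y x = 0}"

definition partial_isometry :: "('k::chilbert_space \<Rightarrow> 'h::chilbert_space) \<Rightarrow> bool"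
  where "partial_isometry V \<longleftrightarrow>
    bounded_clinear V \<and> (\<forall>x \<in> orth {y. V y = 0}. norm (V x) = norm x)"


section \<open>The C*-case and the W*-case\<close>

datatype astar = C_star | W_star

text \<open>A W*-algebra is a C*-algebra that is isometrically the dual of a Banach space (Sakai).  Such a
  Banach space embeds canonically and isometrically into the dual of the algebra, so a predual is a
  norm closed space \<open>V\<close> of bounded functionals for which evaluation is an isometric isomorphism onto
  the dual of \<open>V\<close>.  By Sakai's theorem it is unique, so the choice below is immaterial.\<close>

definition is_predual :: "('m::cstar_algebra \<Rightarrow> complex) set \<Rightarrow> bool"
  where "is_predual V \<longleftrightarrow>
    (\<forall>\<omega>\<in>V. bounded_clinear \<omega>) \<and>
    (\<lambda>a. 0) \<in> V \<and>
    (\<forall>\<omega>\<in>V. \<forall>\<psi>\<in>V. (\<lambda>a. \<omega> a + \<psi> a) \<in> V) \<and>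
    (\<forall>c. \<forall>\<omega>\<in>V. (\<lambda>a. c * \<omega> a) \<in> V) \<and>
    (\<forall>\<omega>. bounded_clinear \<omega> \<and> (\<forall>e>0. \<exists>\<psi>\<in>V. onorm (\<lambda>a. \<omega> a - \<psi> a) < e) \<longrightarrow> \<omega> \<in> V) \<and>
    (\<forall>a. norm a = (SUP \<omega>\<in>{\<omega>\<in>V. onorm \<omega> \<le> 1}. cmod (\<omega> a))) \<and>
    (\<forall>\<Phi> :: ('m \<Rightarrow> complex) \<Rightarrow> complex.
       (\<forall>\<omega>\<in>V. \<forall>\<psi>\<in>V. \<Phi> (\<lambda>a. \<omega> a + \<psi> a) = \<Phi> \<omega> + \<Phi> \<psi>) \<and>
       (\<forall>c. \<forall>\<omega>\<in>V. \<Phi> (\<lambda>a. c * \<omega> a) = c * \<Phi> \<omega>) \<and>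
       (\<exists>C. \<forall>\<omega>\<in>V. cmod (\<Phi> \<omega>) \<le> C * onorm \<omega>)
       \<longrightarrow> (\<exists>a. \<forall>\<omega>\<in>V. \<Phi> \<omega> = \<omega> a))"

definition predual :: "('m::cstar_algebra \<Rightarrow> complex) set"
  where "predual = (SOME V. is_predual V)"

definition astar_algebra :: "astar \<Rightarrow> 'm::cstar_algebra itself \<Rightarrow> bool"
  where "astar_algebra A _ \<longleftrightarrow>
    (A = W_star \<longrightarrow> (\<exists>V :: ('m \<Rightarrow> complex) set. is_predual V))"

text \<open>The topology on \<open>C\<close> generated by a nonempty set \<open>F\<close> of functionals.\<close>

definition weak_topology :: "'a set \<Rightarrow> ('a \<Rightarrow> complex) set \<Rightarrow> 'a topology"
  where "weak_topology C F = topology_generated_by {{x\<in>C. f x \<in> U} | f U. f \<in> F \<and> open U}"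

definition algebra_topology :: "astar \<Rightarrow> 'm::cstar_algebra topology"
  where "algebra_topology A =
    (case A of C_star \<Rightarrow> euclidean | W_star \<Rightarrow> weak_topology UNIV predual)"

definition ultraweak_topology :: "('h::chilbert_space \<Rightarrow> 'h) topology"
  where "ultraweak_topology = weak_topology {B. bounded_clinear B}
    {\<lambda>B. \<Sum>i. cinner (h i) (B (k i)) | (h :: nat \<Rightarrow> 'h) (k :: nat \<Rightarrow> 'h).
      summable (\<lambda>i. (norm (h i))\<^sup>2) \<and> summable (\<lambda>i. (norm (k i))\<^sup>2)}"

locale star_representation =
  fixes A :: astar and \<pi> :: "'m::cstar_algebra \<Rightarrow> 'h::chilbert_space \<Rightarrow> 'h"
  assumes bounded: "bounded_clinear (\<pi> a)"
    and linear: "clinear_on UNIV (\<lambda>a. \<pi> a h)"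
    and mult: "\<pi> (a * b) h = \<pi> a (\<pi> b h)"
    and star: "cinner (\<pi> a h) k = cinner h (\<pi> (star a) k)"
    and nondegenerate: "closure (cspan {\<pi> a h | a h. True}) = UNIV"
    and normal: "A = W_star \<Longrightarrow> continuous_map (algebra_topology A) ultraweak_topology \<pi>"


section \<open>Correspondences\<close>

text \<open>The vector space structure and the norm of the modules come from an ambient complex Banach
  space \<open>'x\<close>, in which several modules can be placed side by side.\<close>

record ('m, 'x) bimodule =
  carr :: "'x set"
  ip :: "'x \<Rightarrow> 'x \<Rightarrow> 'm"
  ract :: "'x \<Rightarrow> 'm \<Rightarrow> 'x"
  lact :: "'m \<Rightarrow> 'x \<Rightarrow> 'x"

text \<open>Completeness of the module is closedness of the carrier.\<close>

locale hilbert_module =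
  fixes E :: "('m::cstar_algebra, 'x::cbanach) bimodule"
  assumes subspace: "csubspace (carr E)"
    and complete: "closed (carr E)"
    and ract_closed: "x \<in> carr E \<Longrightarrow> ract E x a \<in> carr E"
    and ract_linear_left: "clinear_on (carr E) (\<lambda>x. ract E x a)"
    and ract_linear_right: "x \<in> carr E \<Longrightarrow> clinear_on UNIV (\<lambda>a. ract E x a)"
    and ract_mult: "x \<in> carr E \<Longrightarrow> ract E x (a * b) = ract E (ract E x a) b"
    and ip_linear: "x \<in> carr E \<Longrightarrow> clinear_on (carr E) (ip E x)"
    and ip_ract: "x \<in> carr E \<Longrightarrow> y \<in> carr E \<Longrightarrow> ip E x (ract E y a) = ip E x y * a"
    and ip_star: "x \<in> carr E \<Longrightarrow> y \<in> carr E \<Longrightarrow> star (ip E x y) = ip E y x"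
    and ip_positive: "x \<in> carr E \<Longrightarrow> positive_element (ip E x x)"
    and norm_ip: "x \<in> carr E \<Longrightarrow> (norm x)\<^sup>2 = norm (ip E x x)"

definition self_dual :: "('m::cstar_algebra, 'x::cbanach) bimodule \<Rightarrow> bool"
  where "self_dual E \<longleftrightarrow>
    (\<forall>\<theta> :: 'x \<Rightarrow> 'm.
       clinear_on (carr E) \<theta> \<and> (\<forall>x\<in>carr E. \<forall>a. \<theta> (ract E x a) = \<theta> x * a) \<and>
       (\<exists>C. \<forall>x\<in>carr E. norm (\<theta> x) \<le> C * norm x)
       \<longrightarrow> (\<exists>y\<in>carr E. \<forall>x\<in>carr E. \<theta> x = ip E y x))"

definition adjointable :: "('m::cstar_algebra, 'x::cbanach) bimodule \<Rightarrow> ('x \<Rightarrow> 'x) set"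
  where "adjointable E = {B. B ` carr E \<subseteq> carr E \<and>
    (\<exists>B'. B' ` carr E \<subseteq> carr E \<and> (\<forall>x\<in>carr E. \<forall>y\<in>carr E. ip E (B x) y = ip E x (B' y)))}"

text \<open>The weak* topology of the adjointable operators on a self-dual module.\<close>

definition adjointable_topology ::
    "('m::cstar_algebra, 'x::cbanach) bimodule \<Rightarrow> ('x \<Rightarrow> 'x) topology"
  where "adjointable_topology E = weak_topology (adjointable E)
    {\<lambda>B. \<Sum>i. \<omega> i (ip E (x i) (B (y i))) | (\<omega> :: nat \<Rightarrow> 'm \<Rightarrow> complex) x y.
      (\<forall>i. \<omega> i \<in> predual \<and> x i \<in> carr E \<and> y i \<in> carr E) \<and>
      summable (\<lambda>i. onorm (\<omega> i) * norm (x i) * norm (y i))}"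

locale correspondence = hilbert_module E
  for A :: astar and E :: "('m::cstar_algebra, 'x::cbanach) bimodule" +
  assumes lact_closed: "x \<in> carr E \<Longrightarrow> lact E a x \<in> carr E"
    and lact_linear_left: "x \<in> carr E \<Longrightarrow> clinear_on UNIV (\<lambda>a. lact E a x)"
    and lact_mult: "x \<in> carr E \<Longrightarrow> lact E (a * b) x = lact E a (lact E b x)"
    and lact_star: "x \<in> carr E \<Longrightarrow> y \<in> carr E \<Longrightarrow> ip E (lact E a x) y = ip E x (lact E (star a) y)"
    and lact_nondegenerate: "closure (cspan {lact E a x | a x. x \<in> carr E}) = carr E"
    and lact_nonzero: "\<exists>a. \<exists>x\<in>carr E. lact E a x \<noteq> 0"
    and self_dual: "A = W_star \<Longrightarrow> self_dual E"
    and lact_normal: "A = W_star \<Longrightarrow>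
      continuous_map (algebra_topology A) (adjointable_topology E) (lact E)"

definition sigma_topology :: "('m::cstar_algebra, 'x::cbanach) bimodule \<Rightarrow> 'x topology"
  where "sigma_topology E = weak_topology (carr E)
    {\<lambda>x. \<Sum>i. \<omega> i (ip E (y i) x) | (\<omega> :: nat \<Rightarrow> 'm \<Rightarrow> complex) y.
      (\<forall>i. \<omega> i \<in> predual \<and> y i \<in> carr E) \<and> summable (\<lambda>i. onorm (\<omega> i) * norm (y i))}"

definition module_topology ::
    "astar \<Rightarrow> ('m::cstar_algebra, 'x::cbanach) bimodule \<Rightarrow> 'x topology"
  where "module_topology A E =
    (case A of C_star \<Rightarrow> top_of_set (carr E) | W_star \<Rightarrow> sigma_topology E)"

text \<open>\<open>G\<close>, together with the map \<open>(x, y) \<mapsto> t x y\<close>, is the interior tensor product of \<open>F\<close> and \<open>E\<close>: the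
  completion (in the W*-case the self-dual extension, in which the algebraic tensor product is
  dense for the \<open>\<sigma>\<close>-topology) of the algebraic tensor product.  That \<open>t\<close> is bilinear, balanced and
  right \<open>'m\<close>-linear follows from the formula for the inner product.\<close>

definition interior_tensor ::
    "astar \<Rightarrow> ('m::cstar_algebra, 'x::cbanach) bimodule \<Rightarrow> ('m, 'x) bimodule \<Rightarrow> ('m, 'x) bimodule
      \<Rightarrow> ('x \<Rightarrow> 'x \<Rightarrow> 'x) \<Rightarrow> bool"
  where "interior_tensor A F E G t \<longleftrightarrow>
    (\<forall>x\<in>carr F. \<forall>y\<in>carr E. t x y \<in> carr G) \<and>
    (\<forall>x\<in>carr F. \<forall>x'\<in>carr F. \<forall>y\<in>carr E. \<forall>y'\<in>carr E.
       ip G (t x y) (t x' y') = ip E y (lact E (ip F x x') y')) \<and>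
    (\<forall>a. \<forall>x\<in>carr F. \<forall>y\<in>carr E. lact G a (t x y) = t (lact F a x) y) \<and>
    module_topology A G closure_of cspan {t x y | x y. x \<in> carr F \<and> y \<in> carr E} = carr G"

text \<open>For subspaces \<open>Y \<subseteq> Z\<close> of \<open>E\<close>: \<open>Z\<close> is the direct sum of \<open>Y\<close> and its orthogonal complement in \<open>Z\<close>.\<close>

definition complemented_in ::
    "('m::cstar_algebra, 'x::cbanach) bimodule \<Rightarrow> 'x set \<Rightarrow> 'x set \<Rightarrow> bool"
  where "complemented_in E Y Z \<longleftrightarrow>
    Y \<subseteq> Z \<and> (\<forall>z\<in>Z. \<exists>y\<in>Y. \<forall>y'\<in>Y. ip E y' (z - y) = 0)"

definition orth_proj ::
    "('m::cstar_algebra, 'x::cbanach) bimodule \<Rightarrow> 'x set \<Rightarrow> 'x \<Rightarrow> 'x"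
  where "orth_proj E Y z = (THE y. y \<in> Y \<and> (\<forall>y'\<in>Y. ip E y' (z - y) = 0))"


section \<open>Standard subproduct systems\<close>

text \<open>\<open>pow X n\<close> is the \<open>n\<close>-th tensor power of \<open>E = X(1)\<close>, with \<open>tens X n m\<close> identifying the tensor product
  of the \<open>n\<close>-th and the \<open>m\<close>-th power with the \<open>(n + m)\<close>-th power; \<open>fib X n\<close> is the underlying set of
  \<open>X(n)\<close>, a subset of the \<open>n\<close>-th power; and \<open>unt X\<close> identifies \<open>'m\<close>, viewed as a correspondence over
  itself, with the \<open>0\<close>-th power.\<close>

record ('m, 'x) tensor_system =
  pow :: "nat \<Rightarrow> ('m, 'x) bimodule"
  tens :: "nat \<Rightarrow> nat \<Rightarrow> 'x \<Rightarrow> 'x \<Rightarrow> 'x"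
  unt :: "'m \<Rightarrow> 'x"
  fib :: "nat \<Rightarrow> 'x set"

definition fiber :: "('m, 'x) tensor_system \<Rightarrow> nat \<Rightarrow> ('m, 'x) bimodule"
  where "fiber X n = pow X n \<lparr>carr := fib X n\<rparr>"

definition proj :: "('m::cstar_algebra, 'x::cbanach) tensor_system \<Rightarrow> nat \<Rightarrow> 'x \<Rightarrow> 'x"
  where "proj X n = orth_proj (pow X n) (fib X n)"

text \<open>\<open>X(n) \<otimes> X(m)\<close>, as a subset of the \<open>(n + m)\<close>-th tensor power\<close>

definition fib_tensor ::
    "astar \<Rightarrow> ('m::cstar_algebra, 'x::cbanach) tensor_system \<Rightarrow> nat \<Rightarrow> nat \<Rightarrow> 'x set"
  where "fib_tensor A X n m = module_topology A (pow X (n + m)) closure_of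
    cspan {tens X n m x y | x y. x \<in> fib X n \<and> y \<in> fib X m}"

text \<open>The complementability of \<open>X(n)\<close> in the \<open>n\<close>-th tensor power, which makes the projection \<open>proj X n\<close>
  available, is implied by the complementability of \<open>X(n + m)\<close> in \<open>X(n) \<otimes> X(m)\<close>.\<close>

locale standard_subproduct_system =
  fixes A :: astar and X :: "('m::cstar_algebra, 'x::cbanach) tensor_system"
  assumes pow_correspondence: "correspondence A (pow X n)"
    and pow_tensor: "interior_tensor A (pow X n) (pow X m) (pow X (n + m)) (tens X n m)"
    and tens_assoc:
      "x \<in> carr (pow X n) \<Longrightarrow> y \<in> carr (pow X m) \<Longrightarrow> z \<in> carr (pow X l) \<Longrightarrow>
        tens X (n + m) l (tens X n m x y) z = tens X n (m + l) x (tens X m l y z)"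
    and unt_bij: "bij_betw (unt X) UNIV (carr (pow X 0))"
    and unt_linear: "clinear_on UNIV (unt X)"
    and unt_ip: "ip (pow X 0) (unt X a) (unt X b) = star a * b"
    and unt_ract: "ract (pow X 0) (unt X a) b = unt X (a * b)"
    and unt_lact: "lact (pow X 0) a (unt X b) = unt X (a * b)"
    and tens_unt_left: "x \<in> carr (pow X n) \<Longrightarrow> tens X 0 n (unt X a) x = lact (pow X n) a x"
    and tens_unt_right: "x \<in> carr (pow X n) \<Longrightarrow> tens X n 0 x (unt X a) = ract (pow X n) x a"
    and fib_0: "fib X 0 = carr (pow X 0)"
    and fib_1: "fib X 1 = carr (pow X 1)"
    and fib_correspondence: "correspondence A (fiber X n)"
    and fib_complemented_pow: "complemented_in (pow X n) (fib X n) (carr (pow X n))"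
    and fib_complemented: "complemented_in (pow X (n + m)) (fib X (n + m)) (fib_tensor A X n m)"


section \<open>Covariant representations\<close>

locale covariant_representation =
  fixes A :: astar and X :: "('m::cstar_algebra, 'x::cbanach) tensor_system"
    and T :: "nat \<Rightarrow> 'x \<Rightarrow> 'h::chilbert_space \<Rightarrow> 'h"
  assumes rep: "star_representation A (\<lambda>a. T 0 (unt X a))"
    and bounded_op: "\<zeta> \<in> fib X n \<Longrightarrow> bounded_clinear (T n \<zeta>)"
    and linear: "clinear_on (fib X n) (\<lambda>\<zeta>. T n \<zeta> h)"
    and bounded: "\<exists>C. \<forall>\<zeta>\<in>fib X n. onorm (T n \<zeta>) \<le> C * norm \<zeta>"
    and bimodule_map: "\<zeta> \<in> fib X n \<Longrightarrow>
      T n (lact (pow X n) a (ract (pow X n) \<zeta> b)) = T 0 (unt X a) \<circ> T n \<zeta> \<circ> T 0 (unt X b)"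
    and multiplicative: "\<zeta> \<in> fib X n \<Longrightarrow> \<eta> \<in> fib X m \<Longrightarrow>
      T (n + m) (proj X (n + m) (tens X n m \<zeta> \<eta>)) = T n \<zeta> \<circ> T m \<eta>"
    and continuous: "A = W_star \<Longrightarrow>
      continuous_map (sigma_topology (fiber X n)) ultraweak_topology (T n)"

text \<open>The next four definitions are about families of operators defined on a closed subspace of
  \<open>'h\<close>; a covariant representation on \<open>'h\<close> is the case of the subspace \<open>UNIV\<close>.\<close>

definition invariant_subspace ::
    "('m::cstar_algebra, 'x::cbanach) tensor_system \<Rightarrow> (nat \<Rightarrow> 'x \<Rightarrow> 'h::chilbert_space \<Rightarrow> 'h)
      \<Rightarrow> 'h set \<Rightarrow> bool"
  where "invariant_subspace X T S \<longleftrightarrow>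
    closed S \<and> csubspace S \<and> (\<forall>a. T 0 (unt X a) ` S \<subseteq> S) \<and>
    (\<forall>n\<ge>1. \<forall>\<zeta>\<in>fib X n. T n \<zeta> ` S \<subseteq> S)"

definition restrict_rep ::
    "(nat \<Rightarrow> 'x \<Rightarrow> 'h \<Rightarrow> 'h) \<Rightarrow> 'h set \<Rightarrow> nat \<Rightarrow> 'x \<Rightarrow> 'h \<Rightarrow> 'h"
  where "restrict_rep T S = (\<lambda>n \<zeta>. restrict (T n \<zeta>) S)"

definition wander_span ::
    "('m::cstar_algebra, 'x::cbanach) tensor_system \<Rightarrow> (nat \<Rightarrow> 'x \<Rightarrow> 'h::chilbert_space \<Rightarrow> 'h)
      \<Rightarrow> nat \<Rightarrow> 'h set \<Rightarrow> 'h set"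
  where "wander_span X T n S =
    closure (cspan {T n (proj X n \<zeta>) s | \<zeta> s. \<zeta> \<in> carr (pow X n) \<and> s \<in> S})"

text \<open>\<open>W\<close> is a wandering subspace for the family \<open>T\<close> of operators on the closed subspace \<open>H\<close>.\<close>

definition wandering_subspace ::
    "('m::cstar_algebra, 'x::cbanach) tensor_system \<Rightarrow> 'h set
      \<Rightarrow> (nat \<Rightarrow> 'x \<Rightarrow> 'h::chilbert_space \<Rightarrow> 'h) \<Rightarrow> 'h set \<Rightarrow> bool"
  where "wandering_subspace X H T W \<longleftrightarrow>
    closed W \<and> csubspace W \<and> W \<subseteq> H \<and> (\<forall>a. T 0 (unt X a) ` W \<subseteq> W) \<and>
    (\<forall>n\<ge>1. W \<subseteq> orth (wander_span X T n W))"


section \<open>Fock space and shifts\<close>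

text \<open>Elements of the Fock space are sequences.  In the W*-case the series of the inner products is
  required to converge in the weak* topology only; this is the self-dual direct sum.\<close>

definition fock_sums ::
    "astar \<Rightarrow> ('m::cstar_algebra, 'x::cbanach) tensor_system
      \<Rightarrow> (nat \<Rightarrow> 'x) \<Rightarrow> (nat \<Rightarrow> 'x) \<Rightarrow> 'm \<Rightarrow> bool"
  where "fock_sums A X x y c \<longleftrightarrow>
    limitin (algebra_topology A) (\<lambda>N. \<Sum>n<N. ip (pow X n) (x n) (y n)) c sequentially"

definition fock :: "astar \<Rightarrow> ('m::cstar_algebra, 'x::cbanach) tensor_system \<Rightarrow> (nat \<Rightarrow> 'x) set"
  where "fock A X = {x. (\<forall>n. x n \<in> fib X n) \<and> (\<exists>c. fock_sums A X x x c)}"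

definition fock_ip ::
    "astar \<Rightarrow> ('m::cstar_algebra, 'x::cbanach) tensor_system \<Rightarrow> (nat \<Rightarrow> 'x) \<Rightarrow> (nat \<Rightarrow> 'x) \<Rightarrow> 'm"
  where "fock_ip A X x y = (THE c. fock_sums A X x y c)"

definition fock_single :: "nat \<Rightarrow> 'x::zero \<Rightarrow> nat \<Rightarrow> 'x"
  where "fock_single n x = (\<lambda>k. if k = n then x else 0)"

text \<open>\<open>S\<^sub>n(\<zeta>)\<close>, on all of the Fock space: its \<open>k\<close>-th component comes from the component of degree \<open>k - n\<close>.\<close>

definition shift ::
    "('m::cstar_algebra, 'x::cbanach) tensor_system \<Rightarrow> nat \<Rightarrow> 'x \<Rightarrow> (nat \<Rightarrow> 'x) \<Rightarrow> (nat \<Rightarrow> 'x)"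
  where "shift X n \<zeta> x =
    (\<lambda>k. if n \<le> k then proj X k (tens X n (k - n) \<zeta> (x (k - n))) else 0)"

text \<open>The Hilbert space \<open>'k\<close>, together with the map \<open>(x, h) \<mapsto> j x h\<close>, is the tensor product of the Fock
  space with the representation \<open>\<pi>\<close>.  The formula for the inner product makes \<open>j\<close> bilinear and
  balanced.\<close>

definition fock_tensor ::
    "astar \<Rightarrow> ('m::cstar_algebra, 'x::cbanach) tensor_system \<Rightarrow> ('m \<Rightarrow> 'e::chilbert_space \<Rightarrow> 'e)
      \<Rightarrow> ((nat \<Rightarrow> 'x) \<Rightarrow> 'e \<Rightarrow> 'k::chilbert_space) \<Rightarrow> bool"
  where "fock_tensor A X \<pi> j \<longleftrightarrow>
    (\<forall>x\<in>fock A X. \<forall>y\<in>fock A X. \<forall>h k. cinner (j x h) (j y k) = cinner h (\<pi> (fock_ip A X x y) k)) \<and>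
    closure (cspan {j x h | x h. x \<in> fock A X}) = UNIV"

text \<open>\<open>R = B \<otimes> I\<close> for an operator \<open>B\<close> on the Fock space; it is determined by \<open>B\<close>.\<close>

definition amplification ::
    "astar \<Rightarrow> ('m::cstar_algebra, 'x::cbanach) tensor_system
      \<Rightarrow> ((nat \<Rightarrow> 'x) \<Rightarrow> 'e::chilbert_space \<Rightarrow> 'k::chilbert_space)
      \<Rightarrow> ((nat \<Rightarrow> 'x) \<Rightarrow> (nat \<Rightarrow> 'x)) \<Rightarrow> ('k \<Rightarrow> 'k) \<Rightarrow> bool"
  where "amplification A X j B R \<longleftrightarrow>
    bounded_clinear R \<and> (\<forall>x\<in>fock A X. \<forall>h. R (j x h) = j (B x) h)"

text \<open>The summand of degree \<open>0\<close> in the tensor product of the Fock space with \<open>\<pi>\<close>\<close>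

definition vacuum_space ::
    "('m::cstar_algebra, 'x::cbanach) tensor_system
      \<Rightarrow> ((nat \<Rightarrow> 'x) \<Rightarrow> 'e::chilbert_space \<Rightarrow> 'k::chilbert_space) \<Rightarrow> 'k set"
  where "vacuum_space X j = closure (cspan {j (fock_single 0 (unt X a)) h | a h. True})"

end

theory Submission
  imports Defs
begin

text \<open>
  Let \<open>N\<close> be the kernel of \<open>V\<close>.  The partial isometry \<open>V\<close> maps the orthogonal complement of \<open>N\<close>
  unitarily onto \<open>S\<close>, so \<open>S\<close> is closed, and \<open>\<langle>V y, V x\<rangle> = \<langle>y, x\<rangle>\<close> for all \<open>y\<close> if \<open>x \<bottom> N\<close>.
  Together with the intertwining relation this turns the condition \<open>V x \<bottom> T\<^sub>1(e) V k\<close> that defines \<open>W\<close>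
  into \<open>x \<bottom> (S\<^sub>1(e) \<otimes> I) k\<close>.  The shift raises the degree, so vectors of degree \<open>0\<close> satisfy this.

  For the converse one would like the vectors \<open>p(e \<otimes> \<eta>) \<otimes> h\<close> with \<open>e \<in> X(1)\<close> and \<open>\<eta> \<in> X(n)\<close> to
  span a dense subspace of the summand of degree \<open>n + 1\<close>.  In the W*-case the \<open>p(e \<otimes> \<eta>)\<close> span a
  subspace of \<open>X(n + 1)\<close> that is dense for the \<open>\<sigma>\<close>-topology only, in which it is not clear that
  \<open>\<zeta> \<mapsto> \<langle>x, \<zeta> \<otimes> h\<rangle>\<close> is continuous for an arbitrary vector \<open>x\<close> of the Fock tensor product.  For
  \<open>x \<bottom> N\<close>, however,
  \<open>\<langle>\<zeta> \<otimes> \<pi>(a) h, x\<rangle> = \<langle>(S\<^sub>n(\<zeta>) \<otimes> I) (a \<otimes> h), x\<rangle> = \<langle>T\<^sub>n(\<zeta>) V (a \<otimes> h), V x\<rangle>\<close>,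
  and the right-hand side is \<open>\<sigma>\<close>-continuous in \<open>\<zeta>\<close> because \<open>T\<^sub>n\<close> is.  So the density argument can be
  carried out in \<open>S\<close>: a vector orthogonal to all \<open>T\<^sub>1(e) s\<close> with \<open>s \<in> S\<close> is orthogonal to all
  \<open>T\<^sub>n(\<zeta>) s\<close> with \<open>n \<ge> 1\<close> (lemma \<open>orth_degree_one_imp_orth\<close>).  This shows that \<open>W\<close> is wandering, and that
  \<open>x\<close> is orthogonal to the vectors of degree at least \<open>1\<close> if \<open>V x \<in> W\<close>.  Since the vectors of finite degree
  are dense (lemma \<open>closure_cspan_single\<close>), such an \<open>x\<close> is in the summand of degree \<open>0\<close>.
\<close>

section \<open>Complex Hilbert spaces\<close>

lemma scaleC_zero_right [simp]: "c *\<^sub>C (0::'a::complex_normed_vector) = 0"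
  using norm_scaleC[of c "0::'a"] by simp

lemma scaleC_zero_left [simp]: "0 *\<^sub>C (x::'a::complex_normed_vector) = 0"
  using norm_scaleC[of 0 x] by simp

lemma scaleC_minus_one: "(-1) *\<^sub>C (x::'a::complex_normed_vector) = - x"
  using scaleR_scaleC[of "-1" x] by simp

lemma scaleC_one [simp]: "1 *\<^sub>C (x::'a::complex_normed_vector) = x"
  using scaleR_scaleC[of 1 x] by simp

lemma scaleC_minus_left: "(- c) *\<^sub>C (x::'a::complex_normed_vector) = - (c *\<^sub>C x)"
  using scaleC_scaleC[of "-1" c x] by (simp add: scaleC_minus_one)

lemma scaleC_minus_right: "c *\<^sub>C (- x::'a::complex_normed_vector) = - (c *\<^sub>C x)"
  using scaleC_scaleC[of c "-1" x] by (simp add: scaleC_minus_one scaleC_minus_left)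

lemma scaleC_diff_right: "c *\<^sub>C (x - y::'a::complex_normed_vector) = c *\<^sub>C x - c *\<^sub>C y"
  using scaleC_add_right[of c x "- y"] by (simp add: scaleC_minus_right)

lemma scaleC_two: "2 *\<^sub>C (x::'a::complex_normed_vector) = x + x"
  using scaleC_add_left[of 1 1 x] by simp

lemma csubspace_0: "csubspace V \<Longrightarrow> 0 \<in> V"
  and csubspace_add: "csubspace V \<Longrightarrow> x \<in> V \<Longrightarrow> y \<in> V \<Longrightarrow> x + y \<in> V"
  and csubspace_scaleC: "csubspace V \<Longrightarrow> x \<in> V \<Longrightarrow> c *\<^sub>C x \<in> V"
  by (auto simp: csubspace_def)

lemma csubspace_diff: "csubspace V \<Longrightarrow> x \<in> V \<Longrightarrow> y \<in> V \<Longrightarrow> x - y \<in> V"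
  using csubspace_add[of V x "(-1) *\<^sub>C y"] csubspace_scaleC[of V y "-1"]
  by (simp add: scaleC_minus_one)

lemma csubspace_Int: "csubspace U \<Longrightarrow> csubspace V \<Longrightarrow> csubspace (U \<inter> V)"
  by (simp add: csubspace_def)

lemma csubspace_imp_subspace: "csubspace V \<Longrightarrow> subspace V"
  by (simp add: csubspace_def subspace_def scaleR_scaleC)

lemma csubspace_cspan: "csubspace (cspan B)"
  unfolding cspan_def by (rule hull_in) (auto simp: csubspace_def)

lemma cspan_superset: "B \<subseteq> cspan B"
  unfolding cspan_def by (rule hull_subset)

lemma cspan_minimal: "B \<subseteq> V \<Longrightarrow> csubspace V \<Longrightarrow> cspan B \<subseteq> V"
  unfolding cspan_def by (rule hull_minimal)

lemma closure_cspan_minimal: "B \<subseteq> V \<Longrightarrow> csubspace V \<Longrightarrow> closed V \<Longrightarrow> closure (cspan B) \<subseteq> V"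
  by (intro closure_minimal cspan_minimal)

lemma closure_cspan_superset: "B \<subseteq> closure (cspan B)"
  using cspan_superset closure_subset by blast

lemma clinear_on_add: "clinear_on V f \<Longrightarrow> x \<in> V \<Longrightarrow> y \<in> V \<Longrightarrow> f (x + y) = f x + f y"
  and clinear_on_scaleC: "clinear_on V f \<Longrightarrow> x \<in> V \<Longrightarrow> f (c *\<^sub>C x) = c *\<^sub>C f x"
  by (auto simp: clinear_on_def)

lemma clinear_on_0: "clinear_on V f \<Longrightarrow> csubspace V \<Longrightarrow> f 0 = 0"
  using clinear_on_scaleC[of V f 0 0] by (simp add: csubspace_0)

lemma clinear_on_diff:
  assumes "clinear_on V f" "csubspace V" "x \<in> V" "y \<in> V"
  shows "f (x - y) = f x - f y"
  using clinear_on_add[OF assms(1), of x "(-1) *\<^sub>C y"] clinear_on_scaleC[OF assms(1), of y "-1"]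
    csubspace_scaleC[OF assms(2), of y "-1"] assms(3,4)
  by (simp add: scaleC_minus_one)

lemma bounded_clinear_imp_bounded_linear:
  assumes "bounded_clinear f"
  shows "bounded_linear f"
proof -
  obtain C where C: "\<And>x. norm (f x) \<le> C * norm x"
    using assms by (auto simp: bounded_clinear_def)
  have "\<And>x y. f (x + y) = f x + f y" "\<And>c x. f (c *\<^sub>C x) = c *\<^sub>C f x"
    using assms by (auto simp: bounded_clinear_def clinear_on_def)
  then show ?thesis
    by (intro bounded_linear_intro[where K = C]) (auto simp: scaleR_scaleC C mult.commute)
qed

lemma csubspace_closure:
  assumes "csubspace V"
  shows "csubspace (closure V)"
proof -
  have scale: "bounded_linear (\<lambda>x::'a. c *\<^sub>C x)" for c
    by (rule bounded_linear_intro[where K = "cmod c"])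
      (auto simp: scaleC_add_right scaleR_scaleC scaleC_scaleC norm_scaleC mult.commute)
  show ?thesis
    unfolding csubspace_def
  proof (intro conjI ballI allI)
    show "0 \<in> closure V" using assms closure_subset csubspace_0 by blast
  next
    fix x y assume "x \<in> closure V" "y \<in> closure V"
    then obtain f g where "\<And>n. f n \<in> V" "f \<longlonglongrightarrow> x" "\<And>n. g n \<in> V" "g \<longlonglongrightarrow> y"
      by (auto simp: closure_sequential)
    then show "x + y \<in> closure V"
      unfolding closure_sequential
      by (intro exI[of _ "\<lambda>n. f n + g n"]) (auto intro: tendsto_add csubspace_add[OF assms])
  next
    fix x c assume "x \<in> closure V"
    then obtain f where "\<And>n. f n \<in> V" "f \<longlonglongrightarrow> x"
      by (auto simp: closure_sequential)
    then show "c *\<^sub>C x \<in> closure V"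
      unfolding closure_sequential
      by (intro exI[of _ "\<lambda>n. c *\<^sub>C f n"])
        (auto intro: bounded_linear.tendsto[OF scale] csubspace_scaleC[OF assms])
  qed
qed

lemma cinner_add_left: "cinner (x + y) z = cinner x z + cinner y z"
  by (metis cinner_add_right cinner_commute complex_cnj_add)

lemma cinner_scaleC_left: "cinner (c *\<^sub>C x) y = cnj c * cinner x y"
  by (metis cinner_commute cinner_scaleC_right complex_cnj_mult)

lemma cinner_zero [simp]: "cinner x 0 = 0" "cinner 0 x = 0"
  using cinner_scaleC_right[of x 0 0] cinner_scaleC_left[of 0 0 x] by auto

lemma cinner_minus: "cinner x (- y) = - cinner x y" "cinner (- x) y = - cinner x y"
  using cinner_scaleC_right[of x "-1" y] cinner_scaleC_left[of "-1" x y]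
  by (auto simp: scaleC_minus_one)

lemma cinner_diff_right: "cinner x (y - z) = cinner x y - cinner x z"
  using cinner_add_right[of x y "- z"] by (simp add: cinner_minus)

lemma cinner_diff_left: "cinner (x - y) z = cinner x z - cinner y z"
  using cinner_add_left[of x "- y" z] by (simp add: cinner_minus)

lemmas cinner_simps =
  cinner_add_left cinner_add_right cinner_diff_left cinner_diff_right
  cinner_scaleC_left cinner_scaleC_right

lemma norm_add_square: "(norm (x + y))\<^sup>2 = (norm x)\<^sup>2 + (norm y)\<^sup>2 + 2 * Re (cinner x y)"
proof -
  have "complex_of_real ((norm (x + y))\<^sup>2) = cinner x x + cinner y y + (cinner x y + cinner y x)"
    unfolding cinner_self[symmetric] by (simp add: cinner_simps)
  then have "(norm (x + y))\<^sup>2 = Re (cinner x x + cinner y y + (cinner x y + cinner y x))"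
    by (metis Re_complex_of_real)
  also have "Re (cinner y x) = Re (cinner x y)"
    by (subst cinner_commute) simp
  ultimately show ?thesis
    by (simp add: cinner_self del: of_real_power)
qed

lemma norm_diff_square: "(norm (x - y))\<^sup>2 = (norm x)\<^sup>2 + (norm y)\<^sup>2 - 2 * Re (cinner x y)"
  using norm_add_square[of x "- y"] by (simp add: cinner_minus)

lemma cinner_Cauchy_Schwarz: "cmod (cinner x y) \<le> norm x * norm y"
proof (cases "x = 0")
  case False
  \<comment> \<open>The vector \<open>\<parallel>x\<parallel>\<^sup>2 y - d x\<close> is \<open>\<parallel>x\<parallel>\<^sup>2\<close> times the component of \<open>y\<close> orthogonal to \<open>x\<close>.\<close>
  define d where "d = cinner x y"
  have "cinner (complex_of_real ((norm x)\<^sup>2) *\<^sub>C y) (d *\<^sub>C x)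
      = complex_of_real ((norm x)\<^sup>2) * (d * cnj d)"
    using cinner_commute[of y x] by (simp add: cinner_simps d_def del: of_real_power)
  also have "\<dots> = complex_of_real ((norm x)\<^sup>2 * (cmod d)\<^sup>2)"
    by (simp add: complex_norm_square del: of_real_power)
  finally have "Re (cinner (complex_of_real ((norm x)\<^sup>2) *\<^sub>C y) (d *\<^sub>C x)) = (norm x)\<^sup>2 * (cmod d)\<^sup>2"
    by (metis Re_complex_of_real)
  then have "0 \<le> ((norm x)\<^sup>2 * norm y)\<^sup>2 + (cmod d * norm x)\<^sup>2 - 2 * ((norm x)\<^sup>2 * (cmod d)\<^sup>2)"
    using norm_diff_square[of "complex_of_real ((norm x)\<^sup>2) *\<^sub>C y" "d *\<^sub>C x"]
      zero_le_power2[of "norm (complex_of_real ((norm x)\<^sup>2) *\<^sub>C y - d *\<^sub>C x)"]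
    by (simp add: norm_scaleC norm_power)
  also have "\<dots> = (norm x)\<^sup>2 * ((norm x * norm y)\<^sup>2 - (cmod d)\<^sup>2)"
    by (simp add: power_mult_distrib algebra_simps power2_eq_square)
  finally have "(cmod d)\<^sup>2 \<le> (norm x * norm y)\<^sup>2"
    using False by (simp add: zero_le_mult_iff)
  then show ?thesis
    unfolding d_def by (rule power2_le_imp_le) simp
qed simp

lemma bounded_linear_cinner_right: "bounded_linear (cinner x)"
  by (rule bounded_linear_intro[where K = "norm x"])
    (auto simp: cinner_simps scaleR_scaleC scaleC_complex_def
      mult.commute[of _ "norm x"] cinner_Cauchy_Schwarz)

lemma bounded_linear_cinner_left: "bounded_linear (\<lambda>y. cinner y x)"
  by (rule bounded_linear_intro[where K = "norm x"])
    (auto simp: cinner_simps scaleR_scaleC scaleC_complex_def cinner_Cauchy_Schwarz)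

lemma closed_csubspace_cinner_left_eq_0:
  "closed {y. cinner y x = 0}" "csubspace {y. cinner y x = 0}"
  using closed_Collect_eq[of "\<lambda>y. cinner y x" "\<lambda>_. 0"] bounded_linear_cinner_left[of x]
  by (auto simp: csubspace_def cinner_simps linear_continuous_on)

lemma closed_csubspace_orth: "closed (orth V)" "csubspace (orth V)"
proof -
  have "orth V = (\<Inter>y\<in>V. {x. cinner y x = 0})"
    by (auto simp: orth_def)
  moreover have "closed {x. cinner y x = 0}" for y
    using closed_Collect_eq[of "cinner y" "\<lambda>_. 0"] bounded_linear_cinner_right[of y]
    by (auto simp: linear_continuous_on)
  ultimately show "closed (orth V)"
    by auto
qed (auto simp: csubspace_def orth_def cinner_simps)

lemma orth_closure_cspan: "orth (closure (cspan B)) = orth B"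
proof
  show "orth (closure (cspan B)) \<subseteq> orth B"
    using closure_cspan_superset[of B] by (auto simp: orth_def)
  show "orth B \<subseteq> orth (closure (cspan B))"
  proof
    fix x assume "x \<in> orth B"
    then have "B \<subseteq> {y. cinner y x = 0}"
      by (auto simp: orth_def)
    then have "closure (cspan B) \<subseteq> {y. cinner y x = 0}"
      by (intro closure_cspan_minimal closed_csubspace_cinner_left_eq_0)
    then show "x \<in> orth (closure (cspan B))"
      by (auto simp: orth_def)
  qed
qed

lemma orth_self_eq_0: "x \<in> V \<Longrightarrow> x \<in> orth V \<Longrightarrow> x = 0"
  using cinner_self[of x] by (auto simp: orth_def)

lemma orth_dense_eq_0:
  assumes "closure (cspan B) = UNIV" "x \<in> orth B"
  shows "x = 0"
  using assms orth_closure_cspan[of B] orth_self_eq_0[of x UNIV] by auto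

lemma parallelogram:
  "(norm (x - y :: 'a::chilbert_space))\<^sup>2 = 2 * (norm x)\<^sup>2 + 2 * (norm y)\<^sup>2 - (norm (x + y))\<^sup>2"
  by (simp add: norm_add_square norm_diff_square)

text \<open>A sequence in \<open>M\<close> whose distances to \<open>x\<close> tend to the infimum is Cauchy by the parallelogram law;
  its limit is the orthogonal projection of \<open>x\<close>.\<close>

lemma orthogonal_decomposition:
  fixes M :: "'a::chilbert_space set"
  assumes M: "closed M" "csubspace M"
  obtains m where "m \<in> M" "x - m \<in> orth M"
proof -
  have ne: "M \<noteq> {}" using csubspace_0[OF M(2)] by auto
  define d where "d = infdist x M"
  have d_le: "d \<le> norm (x - m)" if "m \<in> M" for m
    using infdist_le[OF that, of x] by (simp add: d_def dist_norm)
  have d0: "0 \<le> d" by (simp add: d_def infdist_nonneg)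
  have "\<exists>m\<in>M. norm (x - m) < d + inverse (real (Suc n))" for n
  proof -
    have "infdist x M < d + inverse (real (Suc n))" by (simp add: d_def)
    then have "\<exists>m\<in>M. dist x m < d + inverse (real (Suc n))"
      using ne by (simp add: infdist_def cInf_less_iff[of "(\<lambda>m. dist x m) ` M"] bdd_below_def)
        (meson cINF_less_iff bdd_belowI2 zero_le_dist)
    then show ?thesis by (simp add: dist_norm)
  qed
  then obtain m where m: "\<And>n. m n \<in> M" "\<And>n. norm (x - m n) < d + inverse (real (Suc n))"
    by metis
  have lim_norm: "(\<lambda>n. norm (x - m n)) \<longlonglongrightarrow> d"
  proof (rule tendsto_sandwich[of "\<lambda>_. d" _ _ "\<lambda>n. d + inverse (real (Suc n))"])
    show "(\<lambda>n. d + inverse (real (Suc n))) \<longlonglongrightarrow> d"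
      using tendsto_add[OF tendsto_const LIMSEQ_inverse_real_of_nat, of d] by simp
  qed (use d_le m in \<open>auto intro!: always_eventually less_imp_le\<close>)
  have close: "(norm (m k - m l))\<^sup>2 \<le> 2 * ((norm (x - m k))\<^sup>2 - d\<^sup>2) + 2 * ((norm (x - m l))\<^sup>2 - d\<^sup>2)"
    for k l
  proof -
    have "(1/2) *\<^sub>R (m k + m l) \<in> M"
      by (simp add: scaleR_scaleC csubspace_add csubspace_scaleC M(2) m(1))
    then have "d \<le> norm (x - (1/2) *\<^sub>R (m k + m l))"
      by (rule d_le)
    also have "x - (1/2) *\<^sub>R (m k + m l) = (1/2) *\<^sub>R ((x - m l) + (x - m k))"
      by (simp add: algebra_simps flip: scaleR_add_left)
    finally have "(2 * d)\<^sup>2 \<le> (norm ((x - m l) + (x - m k)))\<^sup>2"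
      using d0 by (intro power_mono) auto
    then show ?thesis
      using parallelogram[of "x - m l" "x - m k"] by (simp add: power_mult_distrib)
  qed
  have "Cauchy m"
  proof (rule CauchyI)
    fix e :: real assume "0 < e"
    have "(\<lambda>n. (norm (x - m n))\<^sup>2 - d\<^sup>2) \<longlonglongrightarrow> 0"
      using tendsto_diff[OF tendsto_power[OF lim_norm, of 2] tendsto_const[of "d\<^sup>2"]] by simp
    then obtain N where N: "\<And>n. n \<ge> N \<Longrightarrow> (norm (x - m n))\<^sup>2 - d\<^sup>2 < e\<^sup>2 / 4"
      using order_tendstoD(2)[of _ 0 sequentially "e\<^sup>2 / 4"] \<open>0 < e\<close>
      by (force simp: eventually_sequentially)
    show "\<exists>N. \<forall>k\<ge>N. \<forall>l\<ge>N. norm (m k - m l) < e"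
    proof (intro exI allI impI)
      fix k l assume "k \<ge> N" "l \<ge> N"
      then have "(norm (m k - m l))\<^sup>2 < e\<^sup>2"
        using close[of k l] N[of k] N[of l] by simp
      then show "norm (m k - m l) < e"
        using \<open>0 < e\<close> by (simp add: power2_less_imp_less)
    qed
  qed
  then obtain p where p: "m \<longlonglongrightarrow> p"
    using Cauchy_convergent_iff convergent_def by blast
  have pM: "p \<in> M"
    using M(1) m(1) p by (metis closed_sequential_limits)
  have "(\<lambda>n. norm (x - m n)) \<longlonglongrightarrow> norm (x - p)"
    by (intro tendsto_intros p)
  then have norm_p: "norm (x - p) = d"
    using LIMSEQ_unique lim_norm by blast
  have "cinner u (x - p) = 0" if u: "u \<in> M" for u
  proof (rule ccontr)
    \<comment> \<open>Otherwise moving \<open>p\<close> in the direction of \<open>u\<close> by a small multiple of the inner product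
      brings it closer to \<open>x\<close>.\<close>
    define q where "q = cinner u (x - p)"
    define t where "t = 1 / ((norm u)\<^sup>2 + 1)"
    assume "cinner u (x - p) \<noteq> 0"
    then have q: "(cmod q)\<^sup>2 > 0" by (simp add: q_def)
    have t: "t > 0" "t * (norm u)\<^sup>2 < 2"
      by (auto simp: t_def divide_simps add_pos_nonneg add_nonneg_pos)
    define c where "c = complex_of_real t * q"
    have "d \<le> norm (x - (p + c *\<^sub>C u))"
      by (intro d_le csubspace_add csubspace_scaleC M(2) pM u)
    then have "d\<^sup>2 \<le> (norm ((x - p) - c *\<^sub>C u))\<^sup>2"
      using d0 by (intro power_mono) (auto simp: algebra_simps)
    also have "\<dots> = d\<^sup>2 + (norm (c *\<^sub>C u))\<^sup>2 - 2 * Re (cinner (x - p) (c *\<^sub>C u))"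
      by (simp add: norm_diff_square norm_p)
    also have "cinner (x - p) (c *\<^sub>C u) = complex_of_real (t * (cmod q)\<^sup>2)"
      using cinner_commute[of "x - p" u] complex_norm_square[of q]
      by (simp add: cinner_scaleC_right c_def q_def)
    also have "(norm (c *\<^sub>C u))\<^sup>2 = t * (t * (norm u)\<^sup>2) * (cmod q)\<^sup>2"
      using t by (simp add: norm_scaleC c_def norm_mult power_mult_distrib power2_eq_square)
    finally have "0 \<le> (t * (cmod q)\<^sup>2) * (t * (norm u)\<^sup>2 - 2)"
      by (simp add: algebra_simps)
    then show False
      using t q mult_pos_neg[of "t * (cmod q)\<^sup>2" "t * (norm u)\<^sup>2 - 2"] by simp
  qed
  then have "x - p \<in> orth M" by (simp add: orth_def)
  with pM that show ?thesis by blast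
qed

lemma cinner_eq_of_isometric_on:
  assumes f: "clinear_on M f" and M: "csubspace M"
    and iso: "\<And>x. x \<in> M \<Longrightarrow> norm (f x) = norm x"
    and "x \<in> M" "y \<in> M"
  shows "cinner (f x) (f y) = cinner x y"
proof -
  have Re: "Re (cinner (f u) (f v)) = Re (cinner u v)" if "u \<in> M" "v \<in> M" for u v
    using norm_add_square[of "f u" "f v"] norm_add_square[of u v] that
    by (simp add: iso csubspace_add[OF M] flip: clinear_on_add[OF f])
  have "Re (cinner (f x) (\<i> *\<^sub>C f y)) = Re (cinner x (\<i> *\<^sub>C y))"
    using Re[of x "\<i> *\<^sub>C y"] assms(4,5)
    by (simp add: csubspace_scaleC[OF M] flip: clinear_on_scaleC[OF f])
  then show ?thesis
    using Re[OF assms(4,5)] by (simp add: cinner_scaleC_right complex_eq_iff)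
qed

lemma closed_csubspace_kernel:
  assumes "bounded_clinear V"
  shows "closed {k. V k = 0}" "csubspace {k. V k = 0}"
proof -
  have "continuous_on UNIV V"
    by (intro linear_continuous_on bounded_clinear_imp_bounded_linear assms)
  then show "closed {k. V k = 0}"
    using closed_Collect_eq[of V "\<lambda>_. 0"] by auto
  have "clinear_on UNIV V" using assms by (simp add: bounded_clinear_def)
  then show "csubspace {k. V k = 0}"
    using clinear_on_0[of UNIV V] clinear_on_add[of UNIV V] clinear_on_scaleC[of UNIV V]
    by (auto simp: csubspace_def)
qed

text \<open>In other words, \<open>V\<^sup>* V x = x\<close> on the initial space of \<open>V\<close>.\<close>

lemma cinner_partial_isometry:
  assumes V: "partial_isometry V" and x: "x \<in> orth {k. V k = 0}"
  shows "cinner (V y) (V x) = cinner y x"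
proof -
  have bV: "bounded_clinear V" and iso: "\<And>x. x \<in> orth {k. V k = 0} \<Longrightarrow> norm (V x) = norm x"
    using V by (auto simp: partial_isometry_def)
  have lin: "clinear_on UNIV V" using bV by (simp add: bounded_clinear_def)
  obtain m where m: "m \<in> {k. V k = 0}" "y - m \<in> orth {k. V k = 0}"
    using orthogonal_decomposition[OF closed_csubspace_kernel[OF bV]] .
  have "V y = V (y - m)"
    using clinear_on_diff[OF lin, of y m] m(1) by (simp add: csubspace_def)
  then have "cinner (V y) (V x) = cinner (V (y - m)) (V x)" by simp
  also have "\<dots> = cinner (y - m) x"
    using lin by (intro cinner_eq_of_isometric_on[OF _ closed_csubspace_orth(2) iso m(2) x])
      (auto simp: clinear_on_def)
  also have "\<dots> = cinner y x"
    using m(1) x by (simp add: cinner_diff_left orth_def)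
  finally show ?thesis .
qed

lemma range_partial_isometry:
  assumes "partial_isometry V"
  shows "range V = V ` orth {k. V k = 0}" "closed (range V)"
proof -
  have bV: "bounded_clinear V" and iso: "\<And>x. x \<in> orth {k. V k = 0} \<Longrightarrow> norm (V x) = norm x"
    using assms by (auto simp: partial_isometry_def)
  have lin: "clinear_on UNIV V" using bV by (simp add: bounded_clinear_def)
  show eq: "range V = V ` orth {k. V k = 0}"
  proof (intro equalityI subsetI)
    fix z assume "z \<in> range V"
    then obtain y where y: "z = V y" by blast
    obtain m where m: "m \<in> {k. V k = 0}" "y - m \<in> orth {k. V k = 0}"
      using orthogonal_decomposition[OF closed_csubspace_kernel[OF bV]] .
    have "z = V (y - m)"
      using clinear_on_diff[OF lin, of y m] m(1) y by (simp add: csubspace_def)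
    then show "z \<in> V ` orth {k. V k = 0}" using m(2) by blast
  qed auto
  have "complete (V ` orth {k. V k = 0})"
    by (rule complete_isometric_image[of 1])
      (auto simp: iso csubspace_imp_subspace closed_csubspace_orth complete_eq_closed
        bounded_clinear_imp_bounded_linear[OF bV])
  then show "closed (range V)"
    using eq by (simp add: complete_eq_closed)
qed

lemma csubspace_range: "bounded_clinear V \<Longrightarrow> csubspace (range V)"
proof -
  assume "bounded_clinear V"
  then have V: "clinear_on UNIV V" by (simp add: bounded_clinear_def)
  have "V 0 = 0"
    using clinear_on_0[OF V] by (simp add: csubspace_def)
  then have "0 \<in> range V"
    by (metis rangeI)
  then show ?thesis
    by (auto simp: csubspace_def simp flip: clinear_on_add[OF V] clinear_on_scaleC[OF V])
qed

section \<open>Representations of C*-algebras are bounded\<close>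

lemma star_0 [simp]: "star (0::'a::cstar_algebra) = 0"
  using star_scaleC[of 0 "0::'a"] by simp

lemma norm_star: "norm (star a) = norm (a::'a::cstar_algebra)"
proof -
  have le: "norm b \<le> norm (star b)" for b :: 'a
  proof (cases "b = 0")
    case False
    have "norm b * norm b \<le> norm (star b) * norm b"
      using norm_mult_ineq[of "star b" b] cstar_identity[of b] by (simp add: power2_eq_square)
    then show ?thesis using False by simp
  qed simp
  show ?thesis using le[of a] le[of "star a"] by (simp add: star_star)
qed

text \<open>In the unitization the element \<open>1 - c\<close> below is a self-adjoint square root of \<open>1 - b\<close>.  It is the
  fixed point of \<open>c \<mapsto> (b + c\<^sup>2) / 2\<close>, a contraction of the ball of radius \<open>1/2\<close>; the uniqueness of
  the fixed point makes it self-adjoint.\<close>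

lemma selfadjoint_sqrt:
  fixes b :: "'a::cstar_algebra"
  assumes b: "star b = b" "norm b \<le> 1/2"
  obtains c where "star c = c" "c + c - c * c = b"
proof -
  define f where "f c = (1/2) *\<^sub>R (b + c * c)" for c
  define B :: "'a set" where "B = cball 0 (1/2)"
  have "\<exists>!c\<in>B. f c = c"
  proof (rule Banach_fix)
    show "complete B" "B \<noteq> {}" by (auto simp: B_def complete_eq_closed)
    show "f ` B \<subseteq> B"
    proof (clarsimp simp: B_def f_def)
      fix c :: 'a assume "norm c * 2 \<le> 1"
      then have "norm c * norm c \<le> (1/2) * (1/2)" by (intro mult_mono) auto
      then have "norm (c * c) \<le> 1/4" using norm_mult_ineq[of c c] by simp
      then show "norm (b + c * c) \<le> 1" using norm_triangle_ineq[of b "c * c"] b(2) by linarith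
    qed
    show "dist (f x) (f y) \<le> 1/2 * dist x y" if "x \<in> B" "y \<in> B" for x y
    proof -
      have "norm x \<le> 1/2" "norm y \<le> 1/2" using that by (auto simp: B_def)
      then have "norm (x * (x - y)) \<le> 1/2 * norm (x - y)" "norm ((x - y) * y) \<le> norm (x - y) * (1/2)"
        by (meson norm_mult_ineq order_trans mult_left_mono mult_right_mono norm_ge_zero)+
      then have "norm (x * (x - y) + (x - y) * y) \<le> norm (x - y)"
        using norm_triangle_ineq[of "x * (x - y)" "(x - y) * y"] by linarith
      moreover have "f x - f y = (1/2) *\<^sub>R (x * (x - y) + (x - y) * y)"
        by (simp add: f_def algebra_simps)
      ultimately show ?thesis by (simp add: dist_norm)
    qed
  qed auto
  then obtain c where c: "c \<in> B" "f c = c" and unique: "\<And>d. d \<in> B \<Longrightarrow> f d = d \<Longrightarrow> d = c"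
    by blast
  have "f (star c) = star (f c)"
    by (simp add: f_def star_add star_mult star_scaleC scaleR_scaleC b(1))
  then have "star c = c"
    using c by (intro unique) (auto simp: B_def norm_star)
  moreover have "c + c - c * c = b"
  proof -
    have "c + c = 2 *\<^sub>R f c" using c(2) by (simp add: scaleR_2)
    then show ?thesis by (simp add: f_def)
  qed
  ultimately show ?thesis using that by blast
qed

context star_representation
begin

lemma rep_add: "\<pi> (a + b) h = \<pi> a h + \<pi> b h"
  and rep_scaleC: "\<pi> (c *\<^sub>C a) h = c *\<^sub>C \<pi> a h"
  and rep_diff: "\<pi> (a - b) h = \<pi> a h - \<pi> b h"
  and rep_0: "\<pi> 0 h = 0"
  using linear[of h] clinear_on_diff[OF linear[of h], of a b] clinear_on_0[OF linear[of h]]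
  by (auto simp: clinear_on_def csubspace_def)

text \<open>If \<open>1 - x\<^sup>* x = (1 - c)\<^sup>2\<close> with a self-adjoint \<open>c\<close>, then \<open>\<parallel>h\<parallel>\<^sup>2 - \<parallel>\<pi> x h\<parallel>\<^sup>2 = \<parallel>h - \<pi> c h\<parallel>\<^sup>2 \<ge> 0\<close>.  The
  factor \<open>2\<close> comes from rescaling \<open>a\<close> to an element \<open>x\<close> of norm \<open>1/2\<close>, for which such a \<open>c\<close> exists by
  \<open>selfadjoint_sqrt\<close>.\<close>

lemma norm_rep_le: "norm (\<pi> a h) \<le> 2 * norm a * norm h"
proof (cases "a = 0")
  case False
  define r where "r = 1 / (2 * norm a)"
  have r: "r > 0" using False by (simp add: r_def)
  define x where "x = r *\<^sub>R a"
  have "norm x = 1/2" using False by (simp add: x_def r_def)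
  then have "norm (star x * x) \<le> 1/2" by (simp only: cstar_identity) (simp add: power2_eq_square)
  then obtain c where c: "star c = c" "c + c - c * c = star x * x"
    using selfadjoint_sqrt[of "star x * x"] by (auto simp: star_mult star_star)
  have "complex_of_real ((norm (\<pi> x h))\<^sup>2) = cinner h (\<pi> (star x * x) h)"
    unfolding cinner_self[symmetric] by (simp add: star mult)
  also have "\<dots> = cinner h (\<pi> c h) + cinner h (\<pi> c h) - cinner (\<pi> c h) (\<pi> c h)"
    unfolding c(2)[symmetric] rep_diff rep_add mult by (simp add: cinner_simps star c(1))
  finally have "(norm (\<pi> x h))\<^sup>2 = Re (cinner h (\<pi> c h) + cinner h (\<pi> c h) - cinner (\<pi> c h) (\<pi> c h))"
    by (metis Re_complex_of_real)
  also have "\<dots> = 2 * Re (cinner h (\<pi> c h)) - (norm (\<pi> c h))\<^sup>2"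
    by (simp add: cinner_self del: of_real_power)
  also have "\<dots> \<le> (norm h)\<^sup>2"
    using norm_diff_square[of h "\<pi> c h"] zero_le_power2[of "norm (h - \<pi> c h)"] by linarith
  finally have "norm (\<pi> x h) \<le> norm h"
    by (rule power2_le_imp_le) simp
  moreover have "\<pi> x h = r *\<^sub>R \<pi> a h"
    by (simp add: x_def scaleR_scaleC rep_scaleC)
  ultimately show ?thesis
    using False by (simp add: r_def divide_simps mult_ac)
qed (simp add: rep_0)

lemma bounded_linear_rep: "bounded_linear (\<lambda>a. \<pi> a h)"
  by (rule bounded_linear_intro[where K = "2 * norm h"])
    (use norm_rep_le in \<open>auto simp: rep_add scaleR_scaleC rep_scaleC mult_ac\<close>)

end

section \<open>Weak topologies\<close>

lemma topspace_weak_topology: "F \<noteq> {} \<Longrightarrow> topspace (weak_topology C F) = C"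
  unfolding weak_topology_def topology_generated_by_topspace by blast

lemma continuous_map_weak_topology:
  assumes "f \<in> F"
  shows "continuous_map (weak_topology C F) euclidean f"
proof -
  have "openin (weak_topology C F) {x \<in> C. f x \<in> U}" if "open U" for U
    unfolding weak_topology_def using assms that by (intro topology_generated_by_Basis) blast
  moreover have "topspace (weak_topology C F) = C"
    using assms by (intro topspace_weak_topology) auto
  ultimately show ?thesis by (simp add: continuous_map_def)
qed

lemma continuous_map_into_weak_topology:
  assumes "\<And>x. x \<in> topspace Y \<Longrightarrow> g x \<in> C"
    and "\<And>f. f \<in> F \<Longrightarrow> continuous_map Y euclidean (\<lambda>x. f (g x))"
    and "F \<noteq> {}"
  shows "continuous_map Y (weak_topology C F) g"
proof -
  have "openin Y (g -` {x \<in> C. f x \<in> U} \<inter> topspace Y)" if "f \<in> F" "open U" for f U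
  proof -
    have "g -` {x \<in> C. f x \<in> U} \<inter> topspace Y = {x \<in> topspace Y. f (g x) \<in> U}"
      using assms(1) by auto
    then show ?thesis
      using assms(2)[OF that(1)] that(2) by (simp add: continuous_map_def)
  qed
  moreover have "g ` topspace Y \<subseteq> topspace (weak_topology C F)"
    using assms(1,3) by (auto simp: topspace_weak_topology)
  ultimately show ?thesis
    unfolding weak_topology_def by (intro continuous_on_generated_topo) auto
qed

text \<open>The functional is the one given by the sequences \<open>h, 0, 0, \<dots>\<close> and \<open>k, 0, 0, \<dots>\<close>.\<close>

lemma continuous_map_ultraweak_topology:
  "continuous_map ultraweak_topology euclidean (\<lambda>B. cinner h (B k))"
  unfolding ultraweak_topology_def
proof (rule continuous_map_weak_topology)
  define h' where "h' = (\<lambda>i::nat. if i = 0 then h else 0)"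
  define k' where "k' = (\<lambda>i::nat. if i = 0 then k else 0)"
  have "(\<Sum>i. cinner (h' i) (B (k' i))) = cinner h (B k)" for B
    using suminf_finite[of "{0}" "\<lambda>i. cinner (h' i) (B (k' i))"] by (simp add: h'_def k'_def)
  moreover have "summable (\<lambda>i. (norm (h' i))\<^sup>2)" "summable (\<lambda>i. (norm (k' i))\<^sup>2)"
    by (rule summable_finite[of "{0}"]; simp add: h'_def k'_def)+
  ultimately have "(\<lambda>B. cinner h (B k)) = (\<lambda>B. \<Sum>i. cinner (h' i) (B (k' i)))
      \<and> summable (\<lambda>i. (norm (h' i))\<^sup>2) \<and> summable (\<lambda>i. (norm (k' i))\<^sup>2)"
    by simp
  then show "(\<lambda>B. cinner h (B k)) \<in> {\<lambda>B. \<Sum>i. cinner (h i) (B (k i)) |h k.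
      summable (\<lambda>i. (norm (h i))\<^sup>2) \<and> summable (\<lambda>i. (norm (k i))\<^sup>2)}"
    by blast
qed

lemma is_predual_predual: "astar_algebra W_star TYPE('m::cstar_algebra) \<Longrightarrow> is_predual (predual :: ('m \<Rightarrow> complex) set)"
  unfolding predual_def astar_algebra_def by (auto intro: someI_ex)

lemma zero_in_predual: "astar_algebra W_star TYPE('m::cstar_algebra) \<Longrightarrow> (\<lambda>_::'m. 0) \<in> predual"
  using is_predual_predual unfolding is_predual_def by blast

text \<open>The norm of \<open>a\<close> is a supremum of the numbers \<open>\<bar>\<omega> a\<bar>\<close>.\<close>

lemma predual_separates:
  fixes a :: "'m::cstar_algebra"
  assumes "astar_algebra W_star TYPE('m)" and "\<And>\<omega>. \<omega> \<in> predual \<Longrightarrow> \<omega> a = 0"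
  shows "a = 0"
proof -
  let ?B = "{\<omega> \<in> predual. onorm \<omega> \<le> 1} :: ('m \<Rightarrow> complex) set"
  have "norm a = (SUP \<omega>\<in>?B. cmod (\<omega> a))"
    using is_predual_predual[OF assms(1)] unfolding is_predual_def by blast
  also have "\<dots> = (SUP \<omega>\<in>?B. 0)"
    using assms(2) by (intro SUP_cong) auto
  also have "\<dots> = 0"
    using zero_in_predual[OF assms(1)] by (intro cSUP_const) (auto simp: onorm_zero)
  finally show ?thesis by simp
qed

lemma topspace_algebra_topology:
  assumes "astar_algebra A TYPE('m::cstar_algebra)"
  shows "topspace (algebra_topology A :: 'm topology) = UNIV"
proof (cases A)
  case W_star
  then have "(predual :: ('m \<Rightarrow> complex) set) \<noteq> {}"
    using assms zero_in_predual by blast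
  then show ?thesis
    using W_star by (simp add: algebra_topology_def topspace_weak_topology)
qed (simp add: algebra_topology_def)

lemma limitin_algebra_topology_unique:
  fixes f :: "nat \<Rightarrow> 'm::cstar_algebra"
  assumes A: "astar_algebra A TYPE('m)"
    and lim: "limitin (algebra_topology A) f c sequentially"
      "limitin (algebra_topology A) f d sequentially"
  shows "c = d"
proof (cases A)
  case C_star
  then show ?thesis
    using lim LIMSEQ_unique by (auto simp: algebra_topology_def)
next
  case W_star
  have "\<omega> (c - d) = 0" if \<omega>: "\<omega> \<in> predual" for \<omega>
  proof -
    have "bounded_clinear \<omega>"
      using is_predual_predual A W_star \<omega> unfolding is_predual_def by blast
    then have "linear \<omega>"
      by (intro bounded_linear.linear bounded_clinear_imp_bounded_linear)
    moreover have "(\<lambda>n. \<omega> (f n)) \<longlonglongrightarrow> \<omega> e" if "limitin (algebra_topology A) f e sequentially" for e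
      using continuous_map_limit[OF continuous_map_weak_topology[OF \<omega>, of UNIV], of f e] that W_star
      by (simp add: algebra_topology_def comp_def)
    then have "\<omega> c = \<omega> d"
      using lim LIMSEQ_unique by blast
    ultimately show ?thesis by (simp add: linear_diff)
  qed
  then show ?thesis
    using predual_separates[of "c - d"] A W_star by simp
qed

text \<open>This is automatic continuity in the C*-case and normality in the W*-case.\<close>

lemma (in star_representation) continuous_map_matrix_coefficient:
  "continuous_map (algebra_topology A) euclidean (\<lambda>a. cinner h (\<pi> a k))"
proof (cases A)
  case C_star
  have "continuous_on UNIV (\<lambda>a. cinner h (\<pi> a k))"
    using bounded_linear_compose[OF bounded_linear_cinner_right[of h] bounded_linear_rep[of k]]
    by (rule linear_continuous_on)
  then show ?thesis
    using C_star by (simp add: algebra_topology_def)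
next
  case W_star
  then show ?thesis
    using continuous_map_compose[OF normal continuous_map_ultraweak_topology[of h k]]
    by (simp add: comp_def)
qed

section \<open>Hilbert modules and projections onto complemented submodules\<close>

context hilbert_module
begin

lemma ip_add_right: "x \<in> carr E \<Longrightarrow> y \<in> carr E \<Longrightarrow> z \<in> carr E \<Longrightarrow> ip E x (y + z) = ip E x y + ip E x z"
  and ip_scaleC_right: "x \<in> carr E \<Longrightarrow> y \<in> carr E \<Longrightarrow> ip E x (c *\<^sub>C y) = c *\<^sub>C ip E x y"
  using ip_linear[of x] by (auto simp: clinear_on_def)

lemma ip_0_right: "x \<in> carr E \<Longrightarrow> ip E x 0 = 0"
  by (rule clinear_on_0[OF ip_linear subspace])

lemma ip_diff_right: "x \<in> carr E \<Longrightarrow> y \<in> carr E \<Longrightarrow> z \<in> carr E \<Longrightarrow> ip E x (y - z) = ip E x y - ip E x z"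
  by (rule clinear_on_diff[OF ip_linear subspace])

lemma ip_add_left:
  assumes "x \<in> carr E" "y \<in> carr E" "z \<in> carr E"
  shows "ip E (x + y) z = ip E x z + ip E y z"
  using ip_star[of z "x + y"] assms
  by (simp add: csubspace_add[OF subspace] ip_add_right star_add ip_star)

lemma ip_scaleC_left:
  assumes "x \<in> carr E" "z \<in> carr E"
  shows "ip E (c *\<^sub>C x) z = cnj c *\<^sub>C ip E x z"
  using ip_star[of z "c *\<^sub>C x"] assms
  by (simp add: csubspace_scaleC[OF subspace] ip_scaleC_right star_scaleC ip_star)

lemma ip_0_left: "x \<in> carr E \<Longrightarrow> ip E 0 x = 0"
  using ip_star[of x 0] ip_0_right[of x] by (simp add: csubspace_0[OF subspace])

lemma eq_0_if_ip_self_0: "x \<in> carr E \<Longrightarrow> ip E x x = 0 \<Longrightarrow> x = 0"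
  using norm_ip[of x] by simp

text \<open>Polarization together with the triangle inequality in \<open>E\<close> bounds the inner product by a
  multiple of the norms; this form of the Cauchy-Schwarz inequality does not involve the order
  of the C*-algebra.\<close>

lemma norm_ip_le:
  assumes x: "x \<in> carr E" and y: "y \<in> carr E"
  shows "norm (ip E x y) \<le> 4 * norm x * norm y"
proof -
  note closed = csubspace_add[OF subspace] csubspace_diff[OF subspace] csubspace_scaleC[OF subspace]
  have unit: "norm (ip E u v) \<le> 4"
    if u: "u \<in> carr E" "norm u = 1" and v: "v \<in> carr E" "norm v = 1" for u v
  proof -
    define q where "q c = ip E (u + c *\<^sub>C v) (u + c *\<^sub>C v)" for c
    have norm_q: "norm (q c) \<le> 4" if "cmod c = 1" for c
    proof -
      have "norm (u + c *\<^sub>C v) \<le> 2"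
        using norm_triangle_ineq[of u "c *\<^sub>C v"] u(2) v(2) that by (simp add: norm_scaleC)
      then have "(norm (u + c *\<^sub>C v))\<^sup>2 \<le> 2\<^sup>2" by (intro power_mono) auto
      then show ?thesis
        using norm_ip[of "u + c *\<^sub>C v"] u v closed by (simp add: q_def)
    qed
    have q: "q c = ip E u u + c *\<^sub>C ip E u v + (cnj c *\<^sub>C ip E v u + (c * cnj c) *\<^sub>C ip E v v)" for c
      using u(1) v(1) closed
      by (simp add: q_def ip_add_left ip_add_right ip_scaleC_left ip_scaleC_right
          scaleC_add_right scaleC_scaleC)
    have "q 1 - q (-1) = 2 *\<^sub>C ip E u v + 2 *\<^sub>C ip E v u"
      unfolding q by (simp add: scaleC_minus_left scaleC_two)
    moreover have "\<i> *\<^sub>C (q (-\<i>) - q \<i>) = 2 *\<^sub>C ip E u v - 2 *\<^sub>C ip E v u"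
      unfolding q
      by (simp add: scaleC_minus_left scaleC_minus_right scaleC_diff_right scaleC_add_right
          scaleC_scaleC scaleC_two)
    moreover have "4 *\<^sub>C ip E u v = 2 *\<^sub>C ip E u v + 2 *\<^sub>C ip E u v"
      using scaleC_add_left[of 2 2] by simp
    ultimately have "4 *\<^sub>C ip E u v = q 1 - q (-1) + \<i> *\<^sub>C (q (-\<i>) - q \<i>)"
      by simp
    then have "norm (4 *\<^sub>C ip E u v) \<le> norm (q 1 - q (-1)) + norm (q (-\<i>) - q \<i>)"
      using norm_triangle_ineq[of "q 1 - q (-1)" "\<i> *\<^sub>C (q (-\<i>) - q \<i>)"] by (simp add: norm_scaleC)
    also have "\<dots> \<le> 4 + 4 + (4 + 4)"
      by (intro add_mono order_trans[OF norm_triangle_ineq4] norm_q) auto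
    finally show ?thesis by (simp add: norm_scaleC)
  qed
  show ?thesis
  proof (cases "x = 0 \<or> y = 0")
    case True
    then show ?thesis using x y by (auto simp: ip_0_left ip_0_right)
  next
    case False
    have "norm (ip E (complex_of_real (1 / norm x) *\<^sub>C x) (complex_of_real (1 / norm y) *\<^sub>C y)) \<le> 4"
      using x y False closed by (intro unit) (auto simp: norm_scaleC norm_divide)
    then show ?thesis
      using x y False closed
      by (simp add: ip_scaleC_left ip_scaleC_right norm_scaleC norm_divide field_simps)
  qed
qed

end

context standard_subproduct_system
begin

lemma hilbert_module_pow: "hilbert_module (pow X n)"
  using pow_correspondence correspondence.axioms by blast

lemma csubspace_fib: "csubspace (fib X n)"
  and lact_fib: "x \<in> fib X n \<Longrightarrow> lact (pow X n) a x \<in> fib X n"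
  and ract_fib: "x \<in> fib X n \<Longrightarrow> ract (pow X n) x a \<in> fib X n"
proof -
  interpret fiber: correspondence A "fiber X n" by (rule fib_correspondence)
  show "csubspace (fib X n)"
    and "x \<in> fib X n \<Longrightarrow> lact (pow X n) a x \<in> fib X n"
    and "x \<in> fib X n \<Longrightarrow> ract (pow X n) x a \<in> fib X n"
    using fiber.subspace fiber.lact_closed[of x a] fiber.ract_closed[of x a]
    by (simp_all add: fiber_def)
qed

lemma fib_subset: "fib X n \<subseteq> carr (pow X n)"
  using fib_complemented_pow by (simp add: complemented_in_def)

lemma unt_in_fib: "unt X a \<in> fib X 0"
  using unt_bij fib_0 by (auto simp: bij_betw_def)

lemma tens_in_pow: "x \<in> carr (pow X n) \<Longrightarrow> y \<in> carr (pow X m) \<Longrightarrow> tens X n m x y \<in> carr (pow X (n + m))"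
  using pow_tensor by (simp add: interior_tensor_def)

text \<open>The inner product formula gives \<open>x \<otimes> 0\<close> the length \<open>0\<close>.\<close>

lemma tens_0_right:
  assumes x: "x \<in> carr (pow X n)"
  shows "tens X n m x 0 = 0"
proof -
  interpret M: correspondence A "pow X m" by (rule pow_correspondence)
  interpret N: hilbert_module "pow X (n + m)" by (rule hilbert_module_pow)
  have 0: "0 \<in> carr (pow X m)" by (rule csubspace_0[OF M.subspace])
  then have "ip (pow X (n + m)) (tens X n m x 0) (tens X n m x 0)
      = ip (pow X m) 0 (lact (pow X m) (ip (pow X n) x x) 0)"
    using pow_tensor x by (simp add: interior_tensor_def)
  also have "\<dots> = 0" by (intro M.ip_0_left M.lact_closed 0)
  finally show ?thesis
    using N.eq_0_if_ip_self_0 tens_in_pow[OF x 0] by blast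
qed

lemma proj_unique:
  assumes "z \<in> carr (pow X n)" "y \<in> fib X n" "\<And>y'. y' \<in> fib X n \<Longrightarrow> ip (pow X n) y' (z - y) = 0"
  shows "proj X n z = y"
  unfolding proj_def orth_proj_def
proof (rule the_equality)
  interpret hilbert_module "pow X n" by (rule hilbert_module_pow)
  fix u assume u: "u \<in> fib X n \<and> (\<forall>y'\<in>fib X n. ip (pow X n) y' (z - u) = 0)"
  have mem: "y - u \<in> fib X n" "z \<in> carr (pow X n)" "y \<in> carr (pow X n)" "u \<in> carr (pow X n)"
    using u assms csubspace_diff[OF csubspace_fib[of n]] fib_subset[of n] by auto
  then have "ip (pow X n) (y - u) (y - u) = ip (pow X n) (y - u) (z - u) - ip (pow X n) (y - u) (z - y)"
    using fib_subset csubspace_diff[OF subspace] by (subst ip_diff_right[symmetric]) auto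
  also have "\<dots> = 0" using u assms(3) mem(1) by simp
  finally show "u = y"
    using eq_0_if_ip_self_0 mem(1) fib_subset by fastforce
qed (use assms in auto)

lemma proj_in_fib: "z \<in> carr (pow X n) \<Longrightarrow> proj X n z \<in> fib X n"
  and ip_diff_proj: "z \<in> carr (pow X n) \<Longrightarrow> y \<in> fib X n \<Longrightarrow> ip (pow X n) y (z - proj X n z) = 0"
proof -
  assume z: "z \<in> carr (pow X n)"
  then obtain u where "u \<in> fib X n" "\<forall>y'\<in>fib X n. ip (pow X n) y' (z - u) = 0"
    using fib_complemented_pow[of n] unfolding complemented_in_def by blast
  then show "proj X n z \<in> fib X n" "y \<in> fib X n \<Longrightarrow> ip (pow X n) y (z - proj X n z) = 0"
    using proj_unique[OF z, of u] by auto
qed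

lemma ip_proj:
  assumes "z \<in> carr (pow X n)" "y \<in> fib X n"
  shows "ip (pow X n) y (proj X n z) = ip (pow X n) y z"
proof -
  interpret hilbert_module "pow X n" by (rule hilbert_module_pow)
  have "y \<in> carr (pow X n)" "proj X n z \<in> carr (pow X n)"
    using proj_in_fib assms fib_subset by auto
  then show ?thesis
    using ip_diff_proj[OF assms] ip_diff_right[of y z "proj X n z"] assms(1) by simp
qed

lemma proj_fib: "z \<in> fib X n \<Longrightarrow> proj X n z = z"
proof -
  interpret hilbert_module "pow X n" by (rule hilbert_module_pow)
  assume "z \<in> fib X n"
  then show ?thesis
    using fib_subset ip_0_right by (intro proj_unique) auto
qed

lemma proj_0: "proj X n 0 = 0"
  by (rule proj_fib[OF csubspace_0[OF csubspace_fib]])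

lemma clinear_on_proj: "clinear_on (carr (pow X n)) (proj X n)"
proof -
  interpret hilbert_module "pow X n" by (rule hilbert_module_pow)
  have rest: "z - proj X n z \<in> carr (pow X n)" if "z \<in> carr (pow X n)" for z
    using that proj_in_fib fib_subset by (blast intro: csubspace_diff[OF subspace])
  show ?thesis
    unfolding clinear_on_def
  proof (intro conjI ballI allI)
    fix y z assume yz: "y \<in> carr (pow X n)" "z \<in> carr (pow X n)"
    show "proj X n (y + z) = proj X n y + proj X n z"
    proof (rule proj_unique)
      fix u assume u: "u \<in> fib X n"
      then have "ip (pow X n) u ((y - proj X n y) + (z - proj X n z)) = 0"
        using yz fib_subset by (subst ip_add_right) (auto simp: rest ip_diff_proj)
      then show "ip (pow X n) u (y + z - (proj X n y + proj X n z)) = 0"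
        by (simp add: algebra_simps)
    qed (intro csubspace_add[OF subspace] csubspace_add[OF csubspace_fib] proj_in_fib yz)+
  next
    fix c z assume z: "z \<in> carr (pow X n)"
    show "proj X n (c *\<^sub>C z) = c *\<^sub>C proj X n z"
    proof (rule proj_unique)
      fix u assume u: "u \<in> fib X n"
      then have "ip (pow X n) u (c *\<^sub>C (z - proj X n z)) = 0"
        using z fib_subset by (subst ip_scaleC_right) (auto simp: rest ip_diff_proj)
      then show "ip (pow X n) u (c *\<^sub>C z - c *\<^sub>C proj X n z) = 0"
        by (simp add: scaleC_diff_right)
    qed (intro csubspace_scaleC[OF subspace] csubspace_scaleC[OF csubspace_fib] proj_in_fib z)+
  qed
qed

text \<open>The constant comes from \<open>norm_ip_le\<close>: the square of the norm of \<open>p z\<close> is the norm of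
  \<open>\<langle>p z, p z\<rangle> = \<langle>p z, z\<rangle>\<close>.\<close>

lemma norm_proj_le:
  assumes z: "z \<in> carr (pow X n)"
  shows "norm (proj X n z) \<le> 4 * norm z"
proof (cases "proj X n z = 0")
  case False
  interpret hilbert_module "pow X n" by (rule hilbert_module_pow)
  have mem: "proj X n z \<in> carr (pow X n)" using proj_in_fib[OF z] fib_subset by auto
  have "(norm (proj X n z))\<^sup>2 = norm (ip (pow X n) (proj X n z) z)"
    using norm_ip[OF mem] ip_proj[OF z proj_in_fib[OF z]] by simp
  also have "\<dots> \<le> norm (proj X n z) * (4 * norm z)"
    using norm_ip_le[OF mem z] by (simp add: mult_ac)
  finally show ?thesis
    using False by (simp add: power2_eq_square)
qed simp

end

section \<open>The coefficients of a covariant representation\<close>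

text \<open>The topology \<open>\<tau>\<close> is going to be the norm topology of a module in the C*-case and its
  \<open>\<sigma>\<close>-topology in the W*-case.\<close>

lemma eq_0_on_closure_of_cspan:
  fixes f :: "'a::complex_normed_vector \<Rightarrow> complex"
  assumes f: "continuous_map \<tau> euclidean f" "clinear_on (topspace \<tau>) f"
    and C: "csubspace (topspace \<tau>)"
    and B: "B \<subseteq> topspace \<tau>" "\<And>b. b \<in> B \<Longrightarrow> f b = 0"
    and z: "z \<in> \<tau> closure_of cspan B"
  shows "f z = 0"
proof -
  let ?K = "{x \<in> topspace \<tau>. f x \<in> {0}}"
  have "csubspace ?K"
    using C clinear_on_0[OF f(2) C] clinear_on_add[OF f(2)] clinear_on_scaleC[OF f(2)]
    by (auto simp: csubspace_def)
  then have "cspan B \<subseteq> ?K"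
    using B by (intro cspan_minimal) auto
  moreover have "closedin \<tau> ?K"
    by (rule closedin_continuous_map_preimage[OF f(1)]) simp
  ultimately have "\<tau> closure_of cspan B \<subseteq> ?K"
    by (rule closure_of_minimal)
  then show ?thesis using z by blast
qed

lemma topspace_module_topology:
  assumes A: "astar_algebra A TYPE('m::cstar_algebra)"
    and 0: "0 \<in> carr (E :: ('m, 'x::cbanach) bimodule)"
  shows "topspace (module_topology A E) = carr E"
proof (cases A)
  case W_star
  let ?F = "{\<lambda>x. \<Sum>i. \<omega> i (ip E (y i) x) | (\<omega> :: nat \<Rightarrow> 'm \<Rightarrow> complex) y.
      (\<forall>i. \<omega> i \<in> predual \<and> y i \<in> carr E) \<and> summable (\<lambda>i. onorm (\<omega> i) * norm (y i))}"
  have "(\<lambda>x. \<Sum>i. (\<lambda>_ _. 0) i (ip E ((\<lambda>_. 0) i) x)) \<in> ?F"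
    using zero_in_predual A W_star 0
    by (intro CollectI exI[of _ "\<lambda>_ _. 0"] exI[of _ "\<lambda>_. 0"]) auto
  then have "topspace (weak_topology (carr E) ?F) = carr E"
    by (intro topspace_weak_topology) blast
  then show ?thesis
    unfolding module_topology_def sigma_topology_def W_star astar.case .
qed (simp add: module_topology_def)

locale covariant_subproduct_system =
  standard_subproduct_system A X + covariant_representation A X T
  for A :: astar and X :: "('m::cstar_algebra, 'x::cbanach) tensor_system"
    and T :: "nat \<Rightarrow> 'x \<Rightarrow> 'h::chilbert_space \<Rightarrow> 'h" +
  assumes A: "astar_algebra A TYPE('m)"
begin

text \<open>The covariance relation is two-sided and \<open>\<M>\<close> need not have a unit.  The relation for the
  left action alone is the multiplicativity of \<open>T\<close> in degrees \<open>0\<close> and \<open>n\<close>.\<close>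

lemma rep_left: "\<zeta> \<in> fib X n \<Longrightarrow> T 0 (unt X a) (T n \<zeta> h) = T n (lact (pow X n) a \<zeta>) h"
  using multiplicative[OF unt_in_fib, of \<zeta> n a] tens_unt_left[of \<zeta> n a] fib_subset[of n]
    proj_fib[OF lact_fib[of \<zeta> n a]]
  by (auto simp: fun_eq_iff)

lemma topspace_pow: "topspace (module_topology A (pow X n)) = carr (pow X n)"
  using A csubspace_0[OF hilbert_module.subspace[OF hilbert_module_pow]]
  by (rule topspace_module_topology)

lemma topspace_fiber: "topspace (module_topology A (fiber X n)) = fib X n"
  using topspace_module_topology[OF A, of "fiber X n"] csubspace_0[OF csubspace_fib]
  by (simp add: fiber_def)

lemma clinear_on_coefficient:
  "clinear_on (carr (pow X n)) (\<lambda>\<zeta>. cinner h (T n (proj X n \<zeta>) k))"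
  using clinear_on_proj[of n] linear[of n k] proj_in_fib[of _ n]
  by (simp add: clinear_on_def cinner_simps scaleC_complex_def)

text \<open>The projection preserves the functionals \<open>\<langle>y, \<cdot>\<rangle>\<close> with \<open>y \<in> X(n)\<close>, which generate the
  \<open>\<sigma>\<close>-topology of \<open>X(n)\<close>.\<close>

lemma continuous_map_proj:
  assumes "A = W_star"
  shows "continuous_map (sigma_topology (pow X n)) (sigma_topology (fiber X n)) (proj X n)"
proof -
  have top: "topspace (sigma_topology (pow X n)) = carr (pow X n)"
    using topspace_pow[of n] assms by (simp add: module_topology_def)
  let ?F = "{\<lambda>x. \<Sum>i. \<omega> i (ip (fiber X n) (y i) x) | (\<omega> :: nat \<Rightarrow> 'm \<Rightarrow> complex) y.
      (\<forall>i. \<omega> i \<in> predual \<and> y i \<in> carr (fiber X n)) \<and> summable (\<lambda>i. onorm (\<omega> i) * norm (y i))}"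
  show ?thesis
    unfolding sigma_topology_def[of "fiber X n"]
  proof (rule continuous_map_into_weak_topology)
    fix x assume "x \<in> topspace (sigma_topology (pow X n))"
    then show "proj X n x \<in> carr (fiber X n)"
      using top by (simp add: fiber_def proj_in_fib)
  next
    fix f assume "f \<in> ?F"
    then obtain \<omega> y where f: "f = (\<lambda>x. \<Sum>i. \<omega> i (ip (pow X n) (y i) x))"
      and \<omega>: "\<And>i. \<omega> i \<in> predual" and y: "\<And>i. y i \<in> fib X n"
      and sum: "summable (\<lambda>i. onorm (\<omega> i) * norm (y i))"
      by (auto simp: fiber_def)
    have "continuous_map (sigma_topology (pow X n)) euclidean f"
      unfolding sigma_topology_def f using \<omega> y sum fib_subset[of n]
      by (intro continuous_map_weak_topology) blast
    then show "continuous_map (sigma_topology (pow X n)) euclidean (\<lambda>x. f (proj X n x))"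
    proof (rule continuous_map_eq)
      fix x assume "x \<in> topspace (sigma_topology (pow X n))"
      then show "f x = f (proj X n x)"
        using top y by (simp add: f ip_proj)
    qed
  next
    have "topspace (weak_topology (carr (fiber X n)) ?F) \<noteq> {}"
      using topspace_fiber[of n] csubspace_0[OF csubspace_fib[of n]] assms
      by (auto simp: module_topology_def sigma_topology_def)
    then show "?F \<noteq> {}"
      unfolding weak_topology_def topology_generated_by_topspace by blast
  qed
qed

text \<open>The projection extends the coefficients of \<open>T\<^sub>n\<close> from \<open>X(n)\<close> to the whole tensor power.  There
  they can be evaluated on tensors, which span a subspace that is dense in the module topology.\<close>

lemma continuous_map_coefficient:
  "continuous_map (module_topology A (pow X n)) euclidean (\<lambda>\<zeta>. cinner h (T n (proj X n \<zeta>) k))"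
proof (cases A)
  case C_star
  obtain C where C: "\<And>\<zeta>. \<zeta> \<in> fib X n \<Longrightarrow> onorm (T n \<zeta>) \<le> C * norm \<zeta>"
    using bounded[of n] by blast
  let ?f = "\<lambda>\<zeta>. cinner h (T n (proj X n \<zeta>) k)"
  define L where "L = norm h * ((\<bar>C\<bar> * 4) * norm k)"
  have bound: "norm (?f \<zeta>) \<le> L * norm \<zeta>" if \<zeta>: "\<zeta> \<in> carr (pow X n)" for \<zeta>
  proof -
    have "onorm (T n (proj X n \<zeta>)) \<le> C * norm (proj X n \<zeta>)"
      by (rule C[OF proj_in_fib[OF \<zeta>]])
    also have "\<dots> \<le> \<bar>C\<bar> * (4 * norm \<zeta>)"
      by (intro mult_mono norm_proj_le \<zeta>) auto
    finally have "norm (T n (proj X n \<zeta>) k) \<le> \<bar>C\<bar> * (4 * norm \<zeta>) * norm k"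
      using onorm[OF bounded_clinear_imp_bounded_linear[OF bounded_op[OF proj_in_fib[OF \<zeta>]]], of k]
      by (meson mult_right_mono norm_ge_zero order_trans)
    then have "norm h * norm (T n (proj X n \<zeta>) k) \<le> norm h * (\<bar>C\<bar> * (4 * norm \<zeta>) * norm k)"
      by (rule mult_left_mono) simp
    then show ?thesis
      using cinner_Cauchy_Schwarz[of h "T n (proj X n \<zeta>) k"] by (simp add: L_def mult_ac)
  qed
  have subspace: "csubspace (carr (pow X n))"
    by (rule hilbert_module.subspace[OF hilbert_module_pow])
  have "L-lipschitz_on (carr (pow X n)) ?f"
  proof (rule lipschitz_onI)
    fix x y assume xy: "x \<in> carr (pow X n)" "y \<in> carr (pow X n)"
    then show "dist (?f x) (?f y) \<le> L * dist x y"
      using bound[OF csubspace_diff[OF subspace xy]]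
      by (simp add: dist_norm clinear_on_diff[OF clinear_on_coefficient subspace])
  qed (simp add: L_def)
  then have "continuous_on (carr (pow X n)) ?f"
    by (rule lipschitz_on_continuous_on)
  then show ?thesis
    using C_star by (simp add: module_topology_def)
next
  case W_star
  then have "continuous_map (sigma_topology (pow X n)) euclidean
      ((\<lambda>B. cinner h (B k)) \<circ> (T n \<circ> proj X n))"
    by (intro continuous_map_compose[OF _ continuous_map_ultraweak_topology]
        continuous_map_compose[OF continuous_map_proj continuous])
  then show ?thesis
    using W_star by (simp add: module_topology_def comp_def)
qed

text \<open>Since \<open>X(n + 1)\<close> lies in the closed span of the \<open>e \<otimes> \<eta>\<close> with \<open>e \<in> X(1)\<close> and \<open>\<eta> \<in> X(n)\<close>, and
  \<open>T\<close> maps the compression of \<open>e \<otimes> \<eta>\<close> to \<open>T\<^sub>1(e) T\<^sub>n(\<eta>)\<close>.\<close>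

lemma orth_degree_one_imp_orth:
  assumes S: "\<And>m \<eta>. \<eta> \<in> fib X m \<Longrightarrow> T m \<eta> ` S \<subseteq> S"
    and w: "w \<in> orth (wander_span X T 1 S)"
    and n: "n \<ge> 1" and \<zeta>: "\<zeta> \<in> fib X n" and s: "s \<in> S"
  shows "cinner (T n \<zeta> s) w = 0"
proof -
  obtain m where m: "n = 1 + m" using n le_iff_add by blast
  let ?B = "{tens X 1 m x y |x y. x \<in> fib X 1 \<and> y \<in> fib X m}"
  let ?f = "\<lambda>\<zeta>. cinner w (T n (proj X n \<zeta>) s)"
  have w': "cinner (T 1 e t) w = 0" if "e \<in> fib X 1" "t \<in> S" for e t
  proof -
    have "T 1 e t \<in> {T 1 (proj X 1 \<zeta>) s |\<zeta> s. \<zeta> \<in> carr (pow X 1) \<and> s \<in> S}"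
      using that proj_fib[of e 1] fib_1 by force
    then show ?thesis
      using w unfolding wander_span_def orth_closure_cspan by (auto simp: orth_def)
  qed
  have "?f \<zeta> = 0"
  proof (rule eq_0_on_closure_of_cspan[where f = ?f and \<tau> = "module_topology A (pow X n)" and B = ?B])
    show "continuous_map (module_topology A (pow X n)) euclidean ?f"
      by (rule continuous_map_coefficient)
    show "clinear_on (topspace (module_topology A (pow X n))) ?f"
      unfolding topspace_pow by (rule clinear_on_coefficient)
    show "csubspace (topspace (module_topology A (pow X n)))"
      unfolding topspace_pow by (rule hilbert_module.subspace[OF hilbert_module_pow])
    show "?B \<subseteq> topspace (module_topology A (pow X n))"
      unfolding topspace_pow m using tens_in_pow fib_subset by blast
    show "\<zeta> \<in> module_topology A (pow X n) closure_of cspan ?B"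
      using fib_complemented[of 1 m] \<zeta> m unfolding complemented_in_def fib_tensor_def by blast
    fix b assume "b \<in> ?B"
    then obtain x y where b: "b = tens X 1 m x y" "x \<in> fib X 1" "y \<in> fib X m" by blast
    then have "T n (proj X n b) s = T 1 x (T m y s)"
      using multiplicative[of x 1 y m] m by simp
    then show "?f b = 0"
      using w'[of x "T m y s"] b S[of y m] s cinner_commute[of w "T 1 x (T m y s)"] by auto
  qed
  then show ?thesis
    using cinner_commute[of "T n \<zeta> s" w] by (simp add: proj_fib[OF \<zeta>])
qed

end

section \<open>The Fock space\<close>

lemma cinner_bounded_clinear_eq_0:
  assumes R: "bounded_clinear R" and B: "closure (cspan B) = UNIV"
    and 0: "\<And>b. b \<in> B \<Longrightarrow> cinner (R b) x = 0"
  shows "cinner (R k) x = 0"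
proof -
  have lin: "clinear_on UNIV R" using R by (simp add: bounded_clinear_def)
  have "closed {k. cinner (R k) x = 0}"
    using bounded_linear_compose[OF bounded_linear_cinner_left bounded_clinear_imp_bounded_linear[OF R]]
    by (intro closed_Collect_eq linear_continuous_on continuous_on_const)
  moreover have "csubspace {k. cinner (R k) x = 0}"
    using clinear_on_0[OF lin] clinear_on_add[OF lin] clinear_on_scaleC[OF lin]
    by (auto simp: csubspace_def cinner_simps)
  ultimately have "closure (cspan B) \<subseteq> {k. cinner (R k) x = 0}"
    using 0 by (intro closure_cspan_minimal) auto
  then show ?thesis using B by auto
qed

context standard_subproduct_system
begin

lemma shift_single:
  assumes "\<zeta> \<in> fib X n"
  shows "shift X n \<zeta> (fock_single m \<eta>) = fock_single (n + m) (proj X (n + m) (tens X n m \<zeta> \<eta>))"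
proof
  fix k
  have \<zeta>: "\<zeta> \<in> carr (pow X n)" using assms fib_subset by auto
  consider "k = n + m" | "n \<le> k" "k - n \<noteq> m" "k \<noteq> n + m" | "k < n" by linarith
  then show "shift X n \<zeta> (fock_single m \<eta>) k = fock_single (n + m) (proj X (n + m) (tens X n m \<zeta> \<eta>)) k"
    by cases (use tens_0_right[OF \<zeta>, of "k - n"] in \<open>auto simp: shift_def fock_single_def proj_0\<close>)
qed

end

locale fock_representation =
  standard_subproduct_system A X + rep: star_representation A \<pi>
  for A :: astar and X :: "('m::cstar_algebra, 'x::cbanach) tensor_system"
    and \<pi> :: "'m \<Rightarrow> 'e::chilbert_space \<Rightarrow> 'e" +
  fixes j :: "(nat \<Rightarrow> 'x) \<Rightarrow> 'e \<Rightarrow> 'k::chilbert_space"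
  assumes A: "astar_algebra A TYPE('m)"
    and tensor: "fock_tensor A X \<pi> j"
begin

lemma fock_ip_eq: "fock_sums A X x y c \<Longrightarrow> fock_ip A X x y = c"
  unfolding fock_ip_def fock_sums_def using limitin_algebra_topology_unique[OF A] by blast

lemma fock_fib: "x \<in> fock A X \<Longrightarrow> x n \<in> fib X n"
  by (simp add: fock_def)

lemma fock_sums_single:
  assumes "\<And>k. x k \<in> fib X k"
  shows "fock_sums A X x (fock_single n y) (ip (pow X n) (x n) y)"
    and "fock_sums A X (fock_single n y) x (ip (pow X n) y (x n))"
proof -
  have 0: "ip (pow X k) (x k) 0 = 0" "ip (pow X k) 0 (x k) = 0" for k
    using hilbert_module.ip_0_right[OF hilbert_module_pow, of "x k" k]
      hilbert_module.ip_0_left[OF hilbert_module_pow, of "x k" k] assms[of k] fib_subset[of k]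
    by auto
  have "(\<Sum>k<N. ip (pow X k) (x k) (fock_single n y k)) = ip (pow X n) (x n) y"
    "(\<Sum>k<N. ip (pow X k) (fock_single n y k) (x k)) = ip (pow X n) y (x n)" if "N \<ge> Suc n" for N
    using that 0 by (simp_all add: fock_single_def if_distrib if_distribR sum.delta cong: if_cong)
  then show "fock_sums A X x (fock_single n y) (ip (pow X n) (x n) y)"
    and "fock_sums A X (fock_single n y) x (ip (pow X n) y (x n))"
    unfolding fock_sums_def
    by (auto intro!: limitin_eventually eventually_sequentiallyI[of "Suc n"]
        simp: topspace_algebra_topology[OF A])
qed

lemma single_in_fock:
  assumes "y \<in> fib X n"
  shows "fock_single n y \<in> fock A X"
proof -
  have "fock_single n y k \<in> fib X k" for k
    using assms csubspace_0[OF csubspace_fib] by (auto simp: fock_single_def)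
  then show ?thesis
    using fock_sums_single(1)[of "fock_single n y" n y] by (auto simp: fock_def)
qed

lemma cinner_j: "x \<in> fock A X \<Longrightarrow> y \<in> fock A X \<Longrightarrow> cinner (j x h) (j y k) = cinner h (\<pi> (fock_ip A X x y) k)"
  using tensor by (simp add: fock_tensor_def)

lemma cinner_j_single:
  assumes "x \<in> fock A X" "y \<in> fib X n"
  shows "cinner (j x h) (j (fock_single n y) k) = cinner h (\<pi> (ip (pow X n) (x n) y) k)"
  using assms fock_ip_eq[OF fock_sums_single(1), of x n y] fock_fib[of x]
  by (simp add: cinner_j single_in_fock)

text \<open>This derives the linearity and the balancedness of \<open>(x, h) \<mapsto> x \<otimes> h\<close> from the formula for the
  inner product.\<close>

lemma j_eqI:
  assumes "\<And>x h. x \<in> fock A X \<Longrightarrow> cinner (j x h) u = cinner (j x h) v"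
  shows "u = v"
proof -
  have "u - v = 0"
    by (rule orth_dense_eq_0[of "{j x h |x h. x \<in> fock A X}"])
      (use tensor assms in \<open>auto simp: fock_tensor_def orth_def cinner_diff_right\<close>)
  then show ?thesis by simp
qed

lemma bounded_clinear_j:
  assumes x: "x \<in> fock A X"
  shows "bounded_clinear (j x)"
proof -
  let ?c = "fock_ip A X x x"
  have lin: "clinear_on UNIV (\<pi> a)" for a
    using rep.bounded by (simp add: bounded_clinear_def)
  have "j x (h + k) = j x h + j x k" for h k
    by (rule j_eqI) (simp add: cinner_j x cinner_simps clinear_on_add[OF lin])
  moreover have "j x (c *\<^sub>C h) = c *\<^sub>C j x h" for c h
    by (rule j_eqI) (simp add: cinner_j x cinner_simps clinear_on_scaleC[OF lin])
  moreover have "norm (j x h) \<le> sqrt (2 * norm ?c) * norm h" for h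
  proof -
    have "complex_of_real ((norm (j x h))\<^sup>2) = cinner h (\<pi> ?c h)"
      unfolding cinner_self[symmetric] by (rule cinner_j[OF x x])
    then have "(norm (j x h))\<^sup>2 = cmod (cinner h (\<pi> ?c h))"
      by (metis norm_of_real abs_of_nonneg zero_le_power2)
    also have "\<dots> \<le> norm h * norm (\<pi> ?c h)"
      by (rule cinner_Cauchy_Schwarz)
    also have "\<dots> \<le> norm h * (2 * norm ?c * norm h)"
      by (intro mult_left_mono rep.norm_rep_le) simp
    also have "\<dots> = (sqrt (2 * norm ?c) * norm h)\<^sup>2"
      by (simp add: power_mult_distrib power2_eq_square)
    finally show ?thesis
      by (rule power2_le_imp_le) simp
  qed
  ultimately show ?thesis
    unfolding bounded_clinear_def clinear_on_def by blast
qed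

lemma j_single_ract:
  assumes y: "y \<in> fib X n"
  shows "j (fock_single n (ract (pow X n) y a)) h = j (fock_single n y) (\<pi> a h)"
proof (rule j_eqI)
  fix x k assume x: "x \<in> fock A X"
  have "ip (pow X n) (x n) (ract (pow X n) y a) = ip (pow X n) (x n) y * a"
    using hilbert_module.ip_ract[OF hilbert_module_pow] fock_fib[OF x] y fib_subset by blast
  then show "cinner (j x k) (j (fock_single n (ract (pow X n) y a)) h)
      = cinner (j x k) (j (fock_single n y) (\<pi> a h))"
    using x y by (simp add: cinner_j_single ract_fib rep.mult)
qed

lemma j_single_orth_vacuum:
  assumes y: "y \<in> fib X n" and n: "n \<ge> 1"
  shows "j (fock_single n y) h \<in> orth (vacuum_space X j)"
  unfolding vacuum_space_def orth_closure_cspan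
proof -
  have "cinner (j (fock_single 0 (unt X a)) k) (j (fock_single n y) h) = 0" for a k
  proof -
    have "fock_single 0 (unt X a) n = 0" using n by (simp add: fock_single_def)
    moreover have "ip (pow X n) 0 y = 0"
      using hilbert_module.ip_0_left[OF hilbert_module_pow] y fib_subset by blast
    ultimately show ?thesis
      using y by (simp add: cinner_j_single single_in_fock unt_in_fib rep.rep_0)
  qed
  then show "j (fock_single n y) h \<in> orth {j (fock_single 0 (unt X a)) h |a h. True}"
    by (auto simp: orth_def)
qed

text \<open>The vectors of finite degree are dense: the squared distance of \<open>x \<otimes> h\<close> to the partial sums
  of its components is \<open>\<langle>h, \<pi>(r\<^sub>N) h\<rangle>\<close>, where \<open>r\<^sub>N\<close> is the tail of the series for \<open>\<langle>x, x\<rangle>\<close>.  It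
  tends to \<open>0\<close> because \<open>\<pi>\<close> is continuous for the topology in which that series converges.\<close>

lemma closure_cspan_single:
  "closure (cspan {j (fock_single n y) h |n y h. y \<in> fib X n}) = UNIV" (is "closure (cspan ?B) = _")
proof -
  have span: "csubspace (cspan ?B)" by (rule csubspace_cspan)
  have "j x h \<in> closure (cspan ?B)" if x: "x \<in> fock A X" for x h
  proof -
    obtain c where c: "fock_sums A X x x c" using x by (auto simp: fock_def)
    have fib: "x n \<in> fib X n" for n by (rule fock_fib[OF x])
    define b where "b n = j (fock_single n (x n)) h" for n
    define u where "u N = (\<Sum>n<N. b n)" for N
    have u_span: "u N \<in> cspan ?B" for N
    proof (induction N)
      case 0
      show ?case using csubspace_0[OF span] by (simp add: u_def)
    next
      case (Suc N)
      have "b N \<in> cspan ?B" using cspan_superset[of ?B] fib by (auto simp: b_def)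
      then show ?case using Suc csubspace_add[OF span] by (simp add: u_def)
    qed
    have sum_right: "cinner z (u N) = (\<Sum>n<N. cinner z (b n))" for z N
      unfolding u_def by (induction N) (auto simp: cinner_simps)
    have sum_left: "cinner (u N) z = (\<Sum>n<N. cinner (b n) z)" for z N
      unfolding u_def by (induction N) (auto simp: cinner_simps)
    have jb: "cinner (j x h) (b n) = cinner h (\<pi> (ip (pow X n) (x n) (x n)) h)" for n
      by (simp add: b_def cinner_j_single x fib)
    have bb: "cinner (b k) (b n) = (if k = n then cinner (j x h) (b n) else 0)" for k n
    proof -
      have "ip (pow X n) 0 (x n) = 0"
        using hilbert_module.ip_0_left[OF hilbert_module_pow] fib fib_subset by blast
      then show ?thesis
        unfolding jb by (auto simp: b_def cinner_j_single single_in_fock fib rep.rep_0)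
          (auto simp: fock_single_def rep.rep_0)
    qed
    have orth: "cinner (u N) (u N) = cinner (j x h) (u N)" for N
      by (simp add: sum_right sum_left bb sum.delta)
    have dist: "(norm (j x h - u N))\<^sup>2
        = Re (cinner h (\<pi> c h)) - Re (cinner h (\<pi> (\<Sum>n<N. ip (pow X n) (x n) (x n)) h))" for N
    proof -
      have "cinner (j x h) (j x h) = cinner h (\<pi> c h)"
        using cinner_j[OF x x] fock_ip_eq[OF c] by simp
      then have "(norm (j x h))\<^sup>2 = Re (cinner h (\<pi> c h))"
        by (metis cinner_self Re_complex_of_real)
      moreover have "(norm (u N))\<^sup>2 = Re (cinner (j x h) (u N))"
        using orth[of N] by (metis cinner_self Re_complex_of_real)
      moreover have "cinner (j x h) (u N) = cinner h (\<pi> (\<Sum>n<N. ip (pow X n) (x n) (x n)) h)"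
        unfolding sum_right jb
        by (induction N) (auto simp: rep.rep_0 rep.rep_add cinner_simps)
      ultimately show ?thesis
        using norm_diff_square[of "j x h" "u N"] by simp
    qed
    have "(\<lambda>N. cinner h (\<pi> (\<Sum>n<N. ip (pow X n) (x n) (x n)) h)) \<longlonglongrightarrow> cinner h (\<pi> c h)"
      using continuous_map_limit[OF rep.continuous_map_matrix_coefficient[of h h]] c
      by (auto simp: fock_sums_def comp_def)
    then have "(\<lambda>N. Re (cinner h (\<pi> c h)) - Re (cinner h (\<pi> (\<Sum>n<N. ip (pow X n) (x n) (x n)) h)))
        \<longlonglongrightarrow> Re (cinner h (\<pi> c h)) - Re (cinner h (\<pi> c h))"
      by (intro tendsto_intros)
    then have "(\<lambda>N. (norm (j x h - u N))\<^sup>2) \<longlonglongrightarrow> 0"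
      by (simp add: dist)
    from tendsto_real_sqrt[OF this] have "(\<lambda>N. norm (u N - j x h)) \<longlonglongrightarrow> 0"
      by (simp add: norm_minus_commute)
    then have "(\<lambda>N. u N - j x h) \<longlonglongrightarrow> 0"
      by (rule tendsto_norm_zero_cancel)
    then have "u \<longlonglongrightarrow> j x h"
      by (rule LIM_zero_cancel)
    then show ?thesis
      unfolding closure_sequential using u_span by blast
  qed
  then have "closure (cspan {j x h |x h. x \<in> fock A X}) \<subseteq> closure (cspan ?B)"
    by (intro closure_cspan_minimal csubspace_closure csubspace_cspan) auto
  then show ?thesis
    using tensor by (auto simp: fock_tensor_def)
qed

end

section \<open>The wandering subspace\<close>

text \<open>Invariance under the representation of \<open>\<M>\<close> follows from \<open>\<langle>T\<^sub>1(e) s, \<sigma>(a) w\<rangle> = \<langle>T\<^sub>1(a\<^sup>* e) s, w\<rangle>\<close>.\<close>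

lemma (in covariant_subproduct_system) wandering_subspace_orth_degree_one:
  assumes S: "closed S" "csubspace S" "\<And>m \<eta>. \<eta> \<in> fib X m \<Longrightarrow> T m \<eta> ` S \<subseteq> S"
  shows "wandering_subspace X S (restrict_rep T S) (S \<inter> orth (wander_span X T 1 S))"
    (is "wandering_subspace X S _ ?W")
proof -
  interpret \<sigma>: star_representation A "\<lambda>a. T 0 (unt X a)" by (rule rep)
  have "T 0 (unt X a) w \<in> ?W" if w: "w \<in> ?W" for a w
  proof
    show "T 0 (unt X a) w \<in> S" using S(3)[OF unt_in_fib] w by blast
    have "cinner (T 1 (proj X 1 \<zeta>) s) (T 0 (unt X a) w) = 0"
      if \<zeta>: "\<zeta> \<in> carr (pow X 1)" and s: "s \<in> S" for \<zeta> s
    proof -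
      have fib: "proj X 1 \<zeta> \<in> fib X 1" by (rule proj_in_fib[OF \<zeta>])
      have "cinner (T 1 (proj X 1 \<zeta>) s) (T 0 (unt X a) w)
          = cinner (T 0 (unt X (star a)) (T 1 (proj X 1 \<zeta>) s)) w"
        by (simp add: \<sigma>.star star_star)
      also have "\<dots> = cinner (T 1 (lact (pow X 1) (star a) (proj X 1 \<zeta>)) s) w"
        by (simp only: rep_left[OF fib])
      also have "\<dots> = 0"
        using w by (intro orth_degree_one_imp_orth[OF S(3) _ _ lact_fib[OF fib] s]) auto
      finally show ?thesis .
    qed
    then show "T 0 (unt X a) w \<in> orth (wander_span X T 1 S)"
      unfolding wander_span_def orth_closure_cspan by (auto simp: orth_def)
  qed
  moreover have "?W \<subseteq> orth (wander_span X (restrict_rep T S) n ?W)" if "n \<ge> 1" for n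
  proof -
    have "cinner (restrict (T n (proj X n \<zeta>)) S s) w = 0"
      if "\<zeta> \<in> carr (pow X n)" "s \<in> ?W" "w \<in> ?W" for \<zeta> s w
      using orth_degree_one_imp_orth[OF S(3) _ \<open>n \<ge> 1\<close> proj_in_fib, of w \<zeta> s] that by simp
    then show ?thesis
      unfolding wander_span_def orth_closure_cspan restrict_rep_def by (force simp: orth_def)
  qed
  moreover have "closed ?W" "csubspace ?W"
    by (intro closed_Int csubspace_Int S(1,2) closed_csubspace_orth)+
  ultimately show ?thesis
    unfolding wandering_subspace_def by (auto simp: restrict_rep_def)
qed

theorem theorem5p3:
  fixes A :: astar
    and X :: "('m::cstar_algebra, 'x::cbanach) tensor_system"
    and \<pi> :: "'m \<Rightarrow> 'e::chilbert_space \<Rightarrow> 'e"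
    and T :: "nat \<Rightarrow> 'x \<Rightarrow> 'h::chilbert_space \<Rightarrow> 'h"
    and j :: "(nat \<Rightarrow> 'x) \<Rightarrow> 'e \<Rightarrow> 'k::chilbert_space"
    and V :: "'k \<Rightarrow> 'h"
    and S W :: "'h set"
  assumes "astar_algebra A TYPE('m)"
    and "standard_subproduct_system A X"
    and "star_representation A \<pi>"
    and "covariant_representation A X T"
    and "fock_tensor A X \<pi> j"
    and "partial_isometry V"
    and "\<And>n \<zeta>. \<zeta> \<in> fib X n \<Longrightarrow>
      \<exists>R. amplification A X j (shift X n \<zeta>) R \<and> V \<circ> R = T n \<zeta> \<circ> V"
    and S_def: "S = range V"
    and W_def: "W = S \<inter> orth (wander_span X T 1 S)"
  shows "invariant_subspace X T S \<and>
    wandering_subspace X S (restrict_rep T S) W \<and>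
    W = V ` (orth {k. V k = 0} \<inter> vacuum_space X j)"
proof -
  interpret standard_subproduct_system A X by fact
  interpret \<pi>: star_representation A \<pi> by fact
  interpret covariant_subproduct_system A X T
    by (intro covariant_subproduct_system.intro covariant_subproduct_system_axioms.intro) fact+
  interpret fock_representation A X \<pi> j
    by (intro fock_representation.intro fock_representation_axioms.intro) fact+
  note intertwine = assms(7)
  have V: "bounded_clinear V"
    using \<open>partial_isometry V\<close> by (simp add: partial_isometry_def)
  have S: "closed S" "csubspace S"
    unfolding S_def by (rule range_partial_isometry csubspace_range \<open>partial_isometry V\<close> V)+
  have T_S: "T n \<zeta> ` S \<subseteq> S" if \<zeta>: "\<zeta> \<in> fib X n" for n \<zeta>
  proof -
    obtain R where "V \<circ> R = T n \<zeta> \<circ> V" using intertwine[OF \<zeta>] by blast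
    then show ?thesis unfolding S_def by (metis image_comp image_mono top_greatest)
  qed
  have "invariant_subspace X T S"
    using S T_S unt_in_fib by (simp add: invariant_subspace_def)
  moreover have "wandering_subspace X S (restrict_rep T S) W"
    unfolding W_def by (intro wandering_subspace_orth_degree_one S T_S)
  moreover have "W = V ` (orth {k. V k = 0} \<inter> vacuum_space X j)"
  proof (intro equalityI subsetI)
    fix w assume w: "w \<in> W"
    then obtain x where x: "x \<in> orth {k. V k = 0}" "w = V x"
      using W_def S_def range_partial_isometry(1)[OF \<open>partial_isometry V\<close>] by blast
    \<comment> \<open>Since \<open>\<pi>\<close> is nondegenerate, it suffices to consider \<open>\<zeta> \<otimes> \<pi>(a) h = (S\<^sub>n(\<zeta>) \<otimes> I) (a \<otimes> h)\<close>, a vector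
      that \<open>V\<close> maps to \<open>T\<^sub>n(\<zeta>) V (a \<otimes> h)\<close>.\<close>
    have perp: "cinner (j (fock_single n y) h) x = 0" if n: "n \<ge> 1" and y: "y \<in> fib X n" for n y h
    proof (rule cinner_bounded_clinear_eq_0[OF bounded_clinear_j[OF single_in_fock[OF y]] \<pi>.nondegenerate])
      fix b assume "b \<in> {\<pi> a h |a h. True}"
      then obtain a h where b: "b = \<pi> a h" by blast
      obtain R where R: "amplification A X j (shift X n y) R" "V \<circ> R = T n y \<circ> V"
        using intertwine[OF y] by blast
      let ?v = "j (fock_single 0 (unt X a)) h"
      have "R ?v = j (shift X n y (fock_single 0 (unt X a))) h"
        using R(1) single_in_fock[OF unt_in_fib] by (simp add: amplification_def)
      also have "shift X n y (fock_single 0 (unt X a)) = fock_single n (ract (pow X n) y a)"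
        using y tens_unt_right[OF subsetD[OF fib_subset y]] proj_fib[OF ract_fib[OF y]]
        by (simp add: shift_single)
      finally have "T n y (V ?v) = V (j (fock_single n y) b)"
        using R(2) by (metis b comp_apply j_single_ract[OF y])
      then have "cinner (j (fock_single n y) b) x = cinner (T n y (V ?v)) w"
        using cinner_partial_isometry[OF \<open>partial_isometry V\<close> x(1)] x(2) by simp
      also have "\<dots> = 0"
        using w by (intro orth_degree_one_imp_orth[OF T_S _ n y]) (auto simp: W_def S_def)
      finally show "cinner (j (fock_single n y) b) x = 0" .
    qed
    have vacuum: "closed (vacuum_space X j)" "csubspace (vacuum_space X j)"
      unfolding vacuum_space_def by (auto intro: csubspace_closure csubspace_cspan)
    obtain v where v: "v \<in> vacuum_space X j" "x - v \<in> orth (vacuum_space X j)"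
      using orthogonal_decomposition[OF vacuum] .
    have "x - v = 0"
    proof (rule orth_dense_eq_0[OF closure_cspan_single])
      have "cinner (j (fock_single n y) h) (x - v) = 0" if y: "y \<in> fib X n" for n y h
      proof (cases "n = 0")
        case True
        then obtain a where "y = unt X a"
          using y unt_bij fib_0 by (auto simp: bij_betw_def)
        then have "j (fock_single n y) h \<in> vacuum_space X j"
          using True closure_cspan_superset by (fastforce simp: vacuum_space_def)
        then show ?thesis using v(2) by (simp add: orth_def)
      next
        case False
        then have "cinner v (j (fock_single n y) h) = 0"
          using j_single_orth_vacuum[OF y] v(1) by (simp add: orth_def)
        then show ?thesis
          using perp[OF _ y] False cinner_commute[of "j (fock_single n y) h" v]
          by (simp add: cinner_diff_right)
      qed
      then show "x - v \<in> orth {j (fock_single n y) h |n y h. y \<in> fib X n}"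
        by (auto simp: orth_def)
    qed
    then show "w \<in> V ` (orth {k. V k = 0} \<inter> vacuum_space X j)"
      using x v(1) by auto
  next
    fix w assume "w \<in> V ` (orth {k. V k = 0} \<inter> vacuum_space X j)"
    then obtain x where x: "x \<in> orth {k. V k = 0}" "x \<in> vacuum_space X j" "w = V x" by blast
    have "cinner (T 1 (proj X 1 \<zeta>) s) w = 0" if \<zeta>: "\<zeta> \<in> carr (pow X 1)" and s: "s \<in> S" for \<zeta> s
    proof -
      obtain k where k: "s = V k" using s S_def by blast
      have fib: "proj X 1 \<zeta> \<in> fib X 1" by (rule proj_in_fib[OF \<zeta>])
      obtain R where R: "amplification A X j (shift X 1 (proj X 1 \<zeta>)) R"
        "V \<circ> R = T 1 (proj X 1 \<zeta>) \<circ> V"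
        using intertwine[OF fib] by blast
      have "cinner (R k) x = 0"
      proof (rule cinner_bounded_clinear_eq_0[where R = R, OF _ closure_cspan_single])
        show "bounded_clinear R" using R(1) by (simp add: amplification_def)
        fix b assume "b \<in> {j (fock_single n y) h |n y h. y \<in> fib X n}"
        then obtain n y h where b: "b = j (fock_single n y) h" and y: "y \<in> fib X n" by blast
        let ?z = "proj X (1 + n) (tens X 1 n (proj X 1 \<zeta>) y)"
        have "?z \<in> fib X (1 + n)"
          using fib y fib_subset by (intro proj_in_fib tens_in_pow) auto
        then have "j (fock_single (1 + n) ?z) h \<in> orth (vacuum_space X j)"
          by (rule j_single_orth_vacuum) simp
        moreover have "R b = j (fock_single (1 + n) ?z) h"
          using R(1) single_in_fock[OF y] shift_single[OF fib] by (simp add: b amplification_def)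
        ultimately show "cinner (R b) x = 0"
          using x(2) cinner_commute[of "R b" x] by (simp add: orth_def)
      qed
      then show ?thesis
        using cinner_partial_isometry[OF \<open>partial_isometry V\<close> x(1), of "R k"] R(2) x(3) k
        by (metis comp_apply)
    qed
    then have "w \<in> orth (wander_span X T 1 S)"
      unfolding wander_span_def orth_closure_cspan by (auto simp: orth_def)
    then show "w \<in> W"
      using x(3) by (simp add: W_def S_def)
  qed
  ultimately show ?thesis by blast
qed

end
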